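(* Let $(X,0)\subsetneq(\mathbb{R}^2,0)$ be a closed definable planar germ such that $\mathrm{Aff}(C_0X)=\mathbb{R}\times\{0\}$ and $X$ is filled horizontally. If $\theta(X,0)\geqslant 2$, then $0\notin\overline{M_X}$.
   Context: "Definable" means definable in a fixed polynomially bounded o-minimal structure on the field $\mathbb{R}$. The germ is represented by a closed definable set $X\subset\mathbb{R}^2$ with $0\in X$. $m(p)=\{x\in X\mid \|p-x\|=d(p,X)\}$ (Euclidean distance), and the medial axis is $M_X=\{p\in\mathbb{R}^2\mid \# m(p)>1\}$. The Peano tangent cone is $C_0X=\{w\mid \exists\,X\ni x_\nu\to 0,\ \exists\,\lambda_\nu>0:\ \lambda_\nu x_\nu\to w\}$; $\mathrm{Aff}$ denotes the affine hull. The assumption on $C_0X$ implies $B(0,2r)\cap X\cap\{x=0\}=\{0\}$ for all small $r>0$, where $B(0,2r)$ is the disk of radius $2r$ centered at $0$. $X$ is called filled horizontally if there is $r_0>0$ such that for every $0<r<r_0$ the set $B(0,2r)\setminus X$ has at most two connected components: one containing $(0,r)$ and (possibly the other) containing $(0,-r)$; that is, every component contains $(0,r)$ or $(0,-r)$. The general curvature is $\theta(X,0)=\sup\{\theta>0\mid (X,0)\subset\{(x,y)\mid |y|\leqslant c|x|^\theta\}\text{ for some constant } c>0\}\in[1,+\infty]$, where inclusion of germs means that the intersection of $X$ with some neighbourhood of $0$ is contained in the right-hand set. *)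

theory Defs
  imports "HOL-Analysis.Analysis"
begin

text \<open>
  A structure on the ordered field of reals is a family \<open>S\<close> where \<open>S n\<close> consists of the definable
  subsets of \<open>\<real>\<^sup>n\<close>; since \<open>n\<close> varies, points of \<open>\<real>\<^sup>n\<close> are lists of length \<open>n\<close>.
  The degenerate case \<open>n = 0\<close> adds nothing: the axioms force \<open>S 0 = {{}, {[]}}\<close>.
\<close>

definition euclid :: "nat \<Rightarrow> real list set" where
  "euclid n = {xs. length xs = n}"

locale o_minimal_structure =
  fixes S :: "nat \<Rightarrow> real list set set"
  assumes subset_euclid: "A \<in> S n \<Longrightarrow> A \<subseteq> euclid n"
    and euclid_mem: "euclid n \<in> S n"
    and union_mem: "A \<in> S n \<Longrightarrow> B \<in> S n \<Longrightarrow> A \<union> B \<in> S n"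
    and complement_mem: "A \<in> S n \<Longrightarrow> euclid n - A \<in> S n"
    and diagonal_mem: "i < n \<Longrightarrow> j < n \<Longrightarrow> {xs \<in> euclid n. xs ! i = xs ! j} \<in> S n"
    and line_times_mem: "A \<in> S n \<Longrightarrow> {x # xs | x xs. xs \<in> A} \<in> S (Suc n)"
    and times_line_mem: "A \<in> S n \<Longrightarrow> {xs @ [x] | x xs. xs \<in> A} \<in> S (Suc n)"
    and projection_mem: "A \<in> S (Suc n) \<Longrightarrow> {xs. \<exists>x. xs @ [x] \<in> A} \<in> S n"
    and addition_mem: "{[x, y, x + y] | x y. True} \<in> S 3"
    and multiplication_mem: "{[x, y, x * y] | x y. True} \<in> S 3"
    \<comment> \<open>o-minimality; \<^const>\<open>is_interval\<close> covers points as well as bounded and unbounded intervals.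
        As all singletons lie in \<open>S 1\<close>, definability is with real parameters.\<close>
    and o_minimal: "S 1 = {(\<lambda>x. [x]) ` (\<Union>F) | F. finite F \<and> (\<forall>I\<in>F. is_interval I)}"

definition definable_function :: "(nat \<Rightarrow> real list set set) \<Rightarrow> (real \<Rightarrow> real) \<Rightarrow> bool" where
  "definable_function S f \<longleftrightarrow> {[t, f t] | t. True} \<in> S 2"

locale polynomially_bounded_o_minimal_structure = o_minimal_structure +
  assumes polynomially_bounded:
    "definable_function S f \<Longrightarrow> \<exists>N::nat. \<forall>\<^sub>F t in at_top. \<bar>f t\<bar> \<le> t ^ N"

text \<open>
  The plane is \<^typ>\<open>real \<times> real\<close>, whose library metric is the Euclidean one.
\<close>

definition definable_planar :: "(nat \<Rightarrow> real list set set) \<Rightarrow> (real \<times> real) set \<Rightarrow> bool" where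
  "definable_planar S X \<longleftrightarrow> {[x, y] | x y. (x, y) \<in> X} \<in> S 2"

definition germ_subset :: "(real \<times> real) set \<Rightarrow> (real \<times> real) set \<Rightarrow> bool" where
  "germ_subset A B \<longleftrightarrow> (\<exists>U. open U \<and> 0 \<in> U \<and> A \<inter> U \<subseteq> B)"

definition nearest_points :: "(real \<times> real) set \<Rightarrow> real \<times> real \<Rightarrow> (real \<times> real) set" where
  "nearest_points X p = {x \<in> X. dist p x = infdist p X}"

text \<open>
  The set of nearest points may be infinite (its \<^const>\<open>card\<close> is then \<open>0\<close>); such points belong to
  the medial axis.
\<close>

definition medial_axis :: "(real \<times> real) set \<Rightarrow> (real \<times> real) set" where
  "medial_axis X = {p. infinite (nearest_points X p) \<or> card (nearest_points X p) > 1}"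

definition tangent_cone :: "(real \<times> real) set \<Rightarrow> (real \<times> real) set" where
  "tangent_cone X = {w. \<exists>(x :: nat \<Rightarrow> real \<times> real) (c :: nat \<Rightarrow> real).
     (\<forall>n. x n \<in> X) \<and> x \<longlonglongrightarrow> 0 \<and> (\<forall>n. c n > 0) \<and> (\<lambda>n. c n *\<^sub>R x n) \<longlonglongrightarrow> w}"

definition filled_horizontally :: "(real \<times> real) set \<Rightarrow> bool" where
  "filled_horizontally X \<longleftrightarrow> (\<exists>r0>0. \<forall>r. 0 < r \<and> r < r0 \<longrightarrow>
     (\<forall>C \<in> components (ball 0 (2 * r) - X). (0, r) \<in> C \<or> (0, - r) \<in> C))"

definition general_curvature :: "(real \<times> real) set \<Rightarrow> ereal" where
  "general_curvature X = Sup (ereal ` {\<theta>. \<theta> > 0 \<and>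
     (\<exists>c>0. germ_subset X {(x, y). \<bar>y\<bar> \<le> c * \<bar>x\<bar> powr \<theta>})})"

end

theory Submission
  imports Defs
begin

text \<open>
  Polynomial boundedness improves \<open>\<theta>(X,0) \<ge> 2\<close> to \<open>\<bar>y\<bar> \<le> c x\<^sup>2\<close> on \<open>X\<close> near \<open>0\<close>. By o-minimality the
  fibres \<open>X\<^sub>x\<close> over small \<open>x > 0\<close> are either all empty or all nonempty, and a gap in them would be
  bounded by graphs of continuous functions, cutting off a component of the complement that
  horizontal filling forbids. So \<open>X\<^sub>x = [-l(x), u(x)]\<close>, and likewise for \<open>x < 0\<close>.
  For definable \<open>u = O(x\<^sup>2)\<close> the second differences near \<open>0\<close> are bounded above by \<open>K t\<^sup>2\<close>, since
  otherwise they would all exceed \<open>K t\<^sup>2\<close> and \<open>u\<close> would grow too fast; hence \<open>u - K x\<^sup>2 / 2\<close> is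
  midpoint concave, across \<open>x = 0\<close> as well, and the same holds for \<open>l\<close>. Therefore the midpoint of \<open>a, b \<in> X\<close> has
  distance at most \<open>K \<bar>a - b\<bar>\<^sup>2 / 8\<close> from \<open>X\<close>, which prevents a point at distance less than \<open>1 / K\<close>
  from having two nearest points.
\<close>

subsection \<open>Definable sets and functions\<close>

lemma eq_map_upt_iff: "ys = map f [0..<m] \<longleftrightarrow> length ys = m \<and> (\<forall>i<m. f i = ys ! i)"
proof
  assume "length ys = m \<and> (\<forall>i<m. f i = ys ! i)"
  thus "ys = map f [0..<m]" by (intro nth_equalityI) auto
qed auto

text \<open>One-point rule in the shape that projection along fresh coordinates produces: the
  defining equation of the tuple is split on both sides of \<open>P\<close>.\<close>

lemma ex_conj_eq_iff:
  assumes "\<And>ys. ys = z \<longleftrightarrow> A ys \<and> B ys"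
  shows "(\<exists>ys. A ys \<and> P ys \<and> B ys) \<longleftrightarrow> P z"
proof -
  have "(\<exists>ys. A ys \<and> P ys \<and> B ys) \<longleftrightarrow> (\<exists>ys. ys = z \<and> P ys)" unfolding assms by blast
  thus ?thesis by simp
qed

text \<open>Definable functions here are total on the reals, so a supremum that fails to exist
  receives the default value 0.\<close>

definition total_Sup :: "real set \<Rightarrow> real" where
  "total_Sup A = (if A \<noteq> {} \<and> bdd_above A then Sup A else 0)"

text \<open>The right-hand side quantifies over real numbers only, so definability can be read off
  from it.\<close>

lemma total_Sup_eq_iff:
  "total_Sup A = s \<longleftrightarrow>
     (if (\<exists>y. y \<in> A) \<and> (\<exists>b. \<forall>y. y \<in> A \<longrightarrow> y \<le> b)
      then (\<forall>y. y \<in> A \<longrightarrow> y \<le> s) \<and> (\<forall>b. (\<forall>y. y \<in> A \<longrightarrow> y \<le> b) \<longrightarrow> s \<le> b) else s = 0)"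
proof (cases "A \<noteq> {} \<and> bdd_above A")
  case True
  hence "(\<forall>y. y \<in> A \<longrightarrow> y \<le> s) \<and> (\<forall>b. (\<forall>y. y \<in> A \<longrightarrow> y \<le> b) \<longrightarrow> s \<le> b) \<longleftrightarrow> Sup A = s"
    by (metis cSup_eq_non_empty cSup_upper cSup_least)
  moreover have "(\<exists>y. y \<in> A) \<and> (\<exists>b. \<forall>y. y \<in> A \<longrightarrow> y \<le> b)" using True by (auto simp: bdd_above_def)
  ultimately show ?thesis using True by (simp add: total_Sup_def)
qed (auto simp: total_Sup_def bdd_above_def)

text \<open>If \<open>I\<close> meets every interval to the right of \<open>a\<close>, any point
  between \<open>a\<close> and a fixed member \<open>u\<close> is squeezed between two members, so
  convexity puts it in \<open>I\<close>. The left side is symmetric.\<close>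

lemma is_interval_dichotomy:
  fixes I :: "real set"
  assumes "is_interval I"
  shows "(\<forall>\<^sub>F x in at_right a. x \<in> I) \<or> (\<forall>\<^sub>F x in at_right a. x \<notin> I)"
    and "(\<forall>\<^sub>F x in at_left a. x \<in> I) \<or> (\<forall>\<^sub>F x in at_left a. x \<notin> I)"
proof -
  show "(\<forall>\<^sub>F x in at_right a. x \<in> I) \<or> (\<forall>\<^sub>F x in at_right a. x \<notin> I)"
  proof (rule disjCI)
    assume "\<not> (\<forall>\<^sub>F x in at_right a. x \<notin> I)"
    hence ex: "\<exists>x. a < x \<and> x < b \<and> x \<in> I" if "a < b" for b
      using that unfolding eventually_at_right_field by blast
    obtain u where u: "a < u" "u \<in> I" using ex[of "a + 1"] by auto
    have "x \<in> I" if "a < x" "x < u" for x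
      using ex[OF that(1)] u that assms unfolding is_interval_1 by (meson less_imp_le)
    thus "\<forall>\<^sub>F x in at_right a. x \<in> I" using u unfolding eventually_at_right_field by blast
  qed
  show "(\<forall>\<^sub>F x in at_left a. x \<in> I) \<or> (\<forall>\<^sub>F x in at_left a. x \<notin> I)"
  proof (rule disjCI)
    assume "\<not> (\<forall>\<^sub>F x in at_left a. x \<notin> I)"
    hence ex: "\<exists>x. b < x \<and> x < a \<and> x \<in> I" if "b < a" for b
      using that unfolding eventually_at_left_field by blast
    obtain u where u: "u < a" "u \<in> I" using ex[of "a - 1"] by auto
    have "x \<in> I" if "u < x" "x < a" for x
      using ex[OF that(2)] u that assms unfolding is_interval_1 by (meson less_imp_le)
    thus "\<forall>\<^sub>F x in at_left a. x \<in> I" using u unfolding eventually_at_left_field by blast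
  qed
qed

lemma Union_dichotomy:
  assumes "finite F" "\<And>I. I \<in> F \<Longrightarrow> (\<forall>\<^sub>F x in L. x \<in> I) \<or> (\<forall>\<^sub>F x in L. x \<notin> I)"
  shows "(\<forall>\<^sub>F x in L. x \<in> \<Union>F) \<or> (\<forall>\<^sub>F x in L. x \<notin> \<Union>F)"
proof (cases "\<exists>I\<in>F. \<forall>\<^sub>F x in L. x \<in> I")
  case True
  then obtain I where I: "I \<in> F" "\<forall>\<^sub>F x in L. x \<in> I" by blast
  have "\<forall>\<^sub>F x in L. x \<in> \<Union>F" using I(2) by eventually_elim (use I(1) in blast)
  thus ?thesis ..
next
  case False
  hence "\<forall>\<^sub>F x in L. \<forall>I\<in>F. x \<notin> I" using assms by (intro eventually_ball_finite) auto
  thus ?thesis by auto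
qed

section \<open>Definability calculus for predicates and terms\<close>

context o_minimal_structure
begin

text \<open>A formula with \<open>n\<close> free variables is a predicate on lists of length
  \<open>n\<close>, so the closure axioms become rules for connectives and quantifiers.\<close>

definition dpred :: "nat \<Rightarrow> (real list \<Rightarrow> bool) \<Rightarrow> bool" where
  "dpred n P \<longleftrightarrow> {xs. length xs = n \<and> P xs} \<in> S n"

text \<open>The graph puts the value in the last coordinate, where projection can eliminate
  it.\<close>

definition dterm :: "nat \<Rightarrow> (real list \<Rightarrow> real) \<Rightarrow> bool" where
  "dterm n t \<longleftrightarrow> dpred (Suc n) (\<lambda>xs. xs ! n = t (take n xs))"

lemma dpred_cong:
  assumes "dpred n P" "\<And>xs. length xs = n \<Longrightarrow> P xs \<longleftrightarrow> Q xs"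
  shows "dpred n Q"
proof -
  have "{xs. length xs = n \<and> P xs} = {xs. length xs = n \<and> Q xs}" using assms(2) by auto
  thus ?thesis using assms(1) by (simp add: dpred_def)
qed

lemma dpred_not:
  assumes "dpred n P"
  shows "dpred n (\<lambda>xs. \<not> P xs)"
proof -
  have "euclid n - {xs. length xs = n \<and> P xs} = {xs. length xs = n \<and> \<not> P xs}"
    by (auto simp: euclid_def)
  thus ?thesis using complement_mem[of "{xs. length xs = n \<and> P xs}" n] assms by (simp add: dpred_def)
qed

lemma dpred_or:
  assumes "dpred n P" "dpred n Q"
  shows "dpred n (\<lambda>xs. P xs \<or> Q xs)"
proof -
  have "{xs. length xs = n \<and> P xs} \<union> {xs. length xs = n \<and> Q xs} = {xs. length xs = n \<and> (P xs \<or> Q xs)}"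
    by auto
  thus ?thesis using union_mem[OF assms[unfolded dpred_def]] by (simp only: dpred_def)
qed

lemma dpred_and:
  assumes "dpred n P" "dpred n Q"
  shows "dpred n (\<lambda>xs. P xs \<and> Q xs)"
  using dpred_not[OF dpred_or[OF dpred_not[OF assms(1)] dpred_not[OF assms(2)]]] by simp

lemma dpred_imp:
  assumes "dpred n P" "dpred n Q"
  shows "dpred n (\<lambda>xs. P xs \<longrightarrow> Q xs)"
  using dpred_or[OF dpred_not[OF assms(1)] assms(2)] by (simp only: imp_conv_disj)

lemma dpred_True: "dpred n (\<lambda>xs. True)"
  using euclid_mem[of n] by (simp add: dpred_def euclid_def)

lemma dpred_all_less:
  assumes "\<And>i. i < (m::nat) \<Longrightarrow> dpred n (P i)"
  shows "dpred n (\<lambda>xs. \<forall>i<m. P i xs)"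
  using assms
proof (induction m)
  case (Suc m)
  have "dpred n (\<lambda>xs. P m xs \<and> (\<forall>i<m. P i xs))"
    using Suc by (intro dpred_and) auto
  thus ?case by (rule dpred_cong) (auto simp: less_Suc_eq)
qed (simp add: dpred_True)

lemma dpred_append_ex:
  assumes "dpred (Suc n) P"
  shows "dpred n (\<lambda>xs. \<exists>x. P (xs @ [x]))"
proof -
  have "{xs. \<exists>x. xs @ [x] \<in> {xs. length xs = Suc n \<and> P xs}} = {xs. length xs = n \<and> (\<exists>x. P (xs @ [x]))}"
    by auto
  thus ?thesis using projection_mem[OF assms[unfolded dpred_def]] by (simp only: dpred_def)
qed

lemma dpred_append_exs:
  assumes "dpred (n + m) P"
  shows "dpred n (\<lambda>xs. \<exists>ys. length ys = m \<and> P (xs @ ys))"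
  using assms
proof (induction m arbitrary: P)
  case 0
  thus ?case by simp
next
  case (Suc m)
  have "dpred n (\<lambda>xs. \<exists>ys. length ys = m \<and> (\<exists>x. P ((xs @ ys) @ [x])))"
    by (rule Suc.IH, rule dpred_append_ex) (use Suc.prems in simp)
  thus ?case
  proof (rule dpred_cong)
    fix xs :: "real list"
    show "(\<exists>ys. length ys = m \<and> (\<exists>x. P ((xs @ ys) @ [x]))) \<longleftrightarrow> (\<exists>ys. length ys = Suc m \<and> P (xs @ ys))"
      by (simp only: length_Suc_conv_rev append_assoc) blast
  qed
qed

lemma dpred_drop:
  assumes "dpred m P"
  shows "dpred (n + m) (\<lambda>xs. P (drop n xs))"
proof (induction n)
  case 0
  thus ?case using assms by simp
next
  case (Suc n)
  have "{x # xs | x xs. xs \<in> {xs. length xs = n + m \<and> P (drop n xs)}}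
        = {xs. length xs = Suc n + m \<and> P (drop (Suc n) xs)}" (is "?L = ?R")
  proof
    show "?R \<subseteq> ?L" by (auto simp: length_Suc_conv)
  qed auto
  thus ?case using line_times_mem[of "{xs. length xs = n + m \<and> P (drop n xs)}" "n + m"] Suc
    unfolding dpred_def by simp
qed

text \<open>Variables may be permuted, repeated or dropped: \<open>m\<close> fresh coordinates are
  appended, diagonals tie each to its source coordinate, and projection removes them.\<close>

lemma dpred_subst:
  assumes "dpred m P" "\<And>i. i < m \<Longrightarrow> \<sigma> i < n"
  shows "dpred n (\<lambda>xs. P (map (\<lambda>i. xs ! \<sigma> i) [0..<m]))"
proof -
  have "dpred (n + m) (\<lambda>xs. xs ! \<sigma> i = xs ! (n + i))" if "i < m" for i
    using diagonal_mem[of "\<sigma> i" "n + m" "n + i"] assms(2)[OF that] that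
    by (simp add: dpred_def euclid_def)
  hence "dpred (n + m) (\<lambda>xs. P (drop n xs) \<and> (\<forall>i<m. xs ! \<sigma> i = xs ! (n + i)))"
    by (intro dpred_and dpred_drop assms dpred_all_less)
  from dpred_append_exs[OF this] show ?thesis
  proof (rule dpred_cong)
    fix xs :: "real list"
    assume n: "length xs = n"
    have d: "drop n (xs @ ys) = ys" for ys using n by simp
    have *: "ys = map (\<lambda>i. xs ! \<sigma> i) [0..<m] \<longleftrightarrow> length ys = m \<and> (\<forall>i<m. (xs @ ys) ! \<sigma> i = (xs @ ys) ! (n + i))" for ys
    proof -
      have "(xs @ ys) ! \<sigma> i = xs ! \<sigma> i" "(xs @ ys) ! (n + i) = ys ! i" if "i < m" for i
        using n assms(2)[OF that] by (simp_all add: nth_append)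
      thus ?thesis by (simp add: eq_map_upt_iff)
    qed
    from this show "(\<exists>ys. length ys = m \<and> P (drop n (xs @ ys)) \<and> (\<forall>i<m. (xs @ ys) ! \<sigma> i = (xs @ ys) ! (n + i)))
       \<longleftrightarrow> P (map (\<lambda>i. xs ! \<sigma> i) [0..<m])"
      unfolding d by (rule ex_conj_eq_iff)
  qed
qed

text \<open>As for variable substitution, with graphs of the terms in place of diagonals.\<close>

lemma dpred_comp:
  assumes "dpred m P" "\<And>i. i < m \<Longrightarrow> dterm n (t i)"
  shows "dpred n (\<lambda>xs. P (map (\<lambda>i. t i xs) [0..<m]))"
proof -
  have "dpred (n + m) (\<lambda>xs. xs ! (n + i) = t i (take n xs))" if "i < m" for i
  proof -
    \<comment> \<open>Keeping the first \<open>n\<close> coordinates and moving coordinate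
      \<open>n + i\<close> to position \<open>n\<close> yields an instance of the graph of
      \<open>t i\<close>.\<close>
    have "dpred (n + m) (\<lambda>xs. let zs = map (\<lambda>j. xs ! (if j < n then j else n + i)) [0..<Suc n]
             in zs ! n = t i (take n zs))"
      unfolding Let_def
      by (rule dpred_subst[where P = "\<lambda>zs. zs ! n = t i (take n zs)"])
         (use assms(2)[OF that] that in \<open>auto simp: dterm_def\<close>)
    thus ?thesis
    proof (rule dpred_cong)
      fix xs :: "real list"
      assume n: "length xs = n + m"
      let ?zs = "map (\<lambda>j. xs ! (if j < n then j else n + i)) [0..<Suc n]"
      have "?zs ! n = xs ! (n + i)" by (simp add: nth_append)
      moreover have "take n ?zs = take n xs" using n by (auto simp: list_eq_iff_nth_eq nth_append)
      ultimately show "(let zs = ?zs in zs ! n = t i (take n zs)) \<longleftrightarrow> xs ! (n + i) = t i (take n xs)"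
        unfolding Let_def by metis
    qed
  qed
  hence "dpred (n + m) (\<lambda>xs. P (drop n xs) \<and> (\<forall>i<m. xs ! (n + i) = t i (take n xs)))"
    by (intro dpred_and dpred_drop assms dpred_all_less)
  from dpred_append_exs[OF this] show ?thesis
  proof (rule dpred_cong)
    fix xs :: "real list"
    assume n: "length xs = n"
    have d: "drop n (xs @ ys) = ys" for ys using n by simp
    have *: "ys = map (\<lambda>i. t i xs) [0..<m] \<longleftrightarrow> length ys = m \<and> (\<forall>i<m. (xs @ ys) ! (n + i) = t i (take n (xs @ ys)))" for ys
    proof -
      have "(xs @ ys) ! (n + i) = ys ! i" "take n (xs @ ys) = xs" for i
        using n by (simp_all add: nth_append)
      thus ?thesis by (auto simp: eq_map_upt_iff)
    qed
    from this show "(\<exists>ys. length ys = m \<and> P (drop n (xs @ ys)) \<and> (\<forall>i<m. (xs @ ys) ! (n + i) = t i (take n (xs @ ys))))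
       \<longleftrightarrow> P (map (\<lambda>i. t i xs) [0..<m])"
      unfolding d by (rule ex_conj_eq_iff)
  qed
qed

text \<open>A bound variable becomes the last coordinate. The conclusion is a higher-order pattern,
  so the rule applies by unification alone.\<close>

lemma dpred_ex:
  assumes "dpred (Suc n) (\<lambda>xs. P (take n xs) (xs ! n))"
  shows "dpred n (\<lambda>xs. \<exists>x. P xs x)"
  using dpred_append_ex[OF assms] by (rule dpred_cong) (simp add: nth_append)

lemma dpred_all:
  assumes "dpred (Suc n) (\<lambda>xs. P (take n xs) (xs ! n))"
  shows "dpred n (\<lambda>xs. \<forall>x. P xs x)"
  using dpred_not[OF dpred_ex[OF dpred_not[OF assms]]] by simp

lemma dterm_take:
  assumes "dterm n t"
  shows "dterm (Suc n) (\<lambda>xs. t (take n xs))"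
proof -
  have "dpred (Suc (Suc n)) (\<lambda>xs. let zs = map (\<lambda>j. xs ! (if j < n then j else Suc n)) [0..<Suc n]
             in zs ! n = t (take n zs))"
    unfolding Let_def
    by (rule dpred_subst[where P = "\<lambda>zs. zs ! n = t (take n zs)"])
       (use assms in \<open>auto simp: dterm_def\<close>)
  thus ?thesis unfolding dterm_def
  proof (rule dpred_cong)
    fix xs :: "real list"
    assume n: "length xs = Suc (Suc n)"
    let ?zs = "map (\<lambda>j. xs ! (if j < n then j else Suc n)) [0..<Suc n]"
    have "?zs ! n = xs ! Suc n" by (simp add: nth_append)
    moreover have "take n ?zs = take n (take (Suc n) xs)" using n by (auto simp: list_eq_iff_nth_eq nth_append)
    ultimately show "(let zs = ?zs in zs ! n = t (take n zs)) \<longleftrightarrow> xs ! Suc n = t (take n (take (Suc n) xs))"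
      unfolding Let_def by metis
  qed
qed

lemma dterm_nth:
  assumes "i < n"
  shows "dterm n (\<lambda>xs. xs ! i)"
proof -
  have "dpred (Suc n) (\<lambda>xs. xs ! n = xs ! i)"
    using diagonal_mem[of n "Suc n" i] assms by (simp add: dpred_def euclid_def)
  thus ?thesis unfolding dterm_def using assms by simp
qed

text \<open>One-point intervals give every singleton through o-minimality, so real parameters are
  allowed.\<close>

lemma dterm_const: "dterm n (\<lambda>xs. c)"
proof -
  have "{[c]} \<in> S 1"
    unfolding o_minimal by (auto simp: is_interval_1 intro!: exI[of _ "{{c}}"])
  moreover have "{xs. length xs = 1 \<and> xs ! 0 = c} = {[c]}" by (auto simp: length_Suc_conv)
  ultimately have "dpred 1 (\<lambda>xs. xs ! 0 = c)" by (simp add: dpred_def)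
  from dpred_subst[OF this, of "\<lambda>_. n" "Suc n"] show ?thesis by (simp add: dterm_def)
qed

lemma dpred_comp2:
  assumes "dpred 2 (\<lambda>xs. P (xs ! 0) (xs ! 1))" "dterm n s" "dterm n t"
  shows "dpred n (\<lambda>xs. P (s xs) (t xs))"
proof -
  have "dterm n (if i = 0 then s else t)" for i :: nat using assms by simp
  from dpred_comp[OF assms(1) this, of id] show ?thesis
    by (simp add: numeral_2_eq_2)
qed

lemma dpred_comp3:
  assumes "dpred 3 (\<lambda>xs. P (xs ! 0) (xs ! 1) (xs ! 2))" "dterm n s" "dterm n t" "dterm n u"
  shows "dpred n (\<lambda>xs. P (s xs) (t xs) (u xs))"
proof -
  have "dterm n (if i = 0 then s else if i = 1 then t else u)" for i :: nat using assms by simp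
  from dpred_comp[OF assms(1) this, of id] show ?thesis
    by (simp add: numeral_2_eq_2 numeral_3_eq_3)
qed

lemma dpred_eq:
  assumes "dterm n s" "dterm n t"
  shows "dpred n (\<lambda>xs. s xs = t xs)"
proof (rule dpred_comp2[OF _ assms])
  show "dpred 2 (\<lambda>xs. xs ! 0 = xs ! 1)"
    using diagonal_mem[of 0 2 1] by (simp add: dpred_def euclid_def)
qed

lemma dterm_if_graph:
  assumes "dpred 2 (\<lambda>xs. xs ! 1 = f (xs ! 0))" "dterm n t"
  shows "dterm n (\<lambda>xs. f (t xs))"
  unfolding dterm_def
  by (rule dpred_comp2[where P = "\<lambda>x y. y = f x"]) (use assms in \<open>auto intro!: dterm_take dterm_nth\<close>)

lemma dterm_if_graph2:
  assumes "{[x, y, f x y] |x y. True} \<in> S 3" "dterm n s" "dterm n t"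
  shows "dterm n (\<lambda>xs. f (s xs) (t xs))"
proof -
  have "{xs. length xs = 3 \<and> xs ! 2 = f (xs ! 0) (xs ! 1)} = {[x, y, f x y] |x y. True}"
    by (auto simp: length_Suc_conv eval_nat_numeral)
  hence "dpred 3 (\<lambda>xs. xs ! 2 = f (xs ! 0) (xs ! 1))" using assms(1) by (simp add: dpred_def)
  thus ?thesis unfolding dterm_def
    by (rule dpred_comp3[where P = "\<lambda>x y z. z = f x y", OF _ dterm_take[OF assms(2)]
          dterm_take[OF assms(3)] dterm_nth]) simp
qed

lemmas dterm_add = dterm_if_graph2[OF addition_mem]
lemmas dterm_mult = dterm_if_graph2[OF multiplication_mem]

lemma dterm_uminus: "dterm n t \<Longrightarrow> dterm n (\<lambda>xs. - t xs)"
  using dterm_mult[OF dterm_const[of n "-1"]] by simp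

lemma dterm_diff: "dterm n s \<Longrightarrow> dterm n t \<Longrightarrow> dterm n (\<lambda>xs. s xs - t xs)"
  using dterm_add[OF _ dterm_uminus] by simp

lemma dterm_power2: "dterm n t \<Longrightarrow> dterm n (\<lambda>xs. (t xs)\<^sup>2)"
  unfolding power2_eq_square by (rule dterm_mult)

lemma dpred_le:
  assumes "dterm n s" "dterm n t"
  shows "dpred n (\<lambda>xs. s xs \<le> t xs)"
proof (rule dpred_comp2[OF _ assms])
  \<comment> \<open>The order comes from the field structure, since the nonnegative reals are
    exactly the squares.\<close>
  have "dpred 2 (\<lambda>xs. \<exists>z. xs ! 1 = xs ! 0 + z\<^sup>2)"
    by (intro dpred_ex dpred_eq dterm_add dterm_power2 dterm_take dterm_nth; simp)
  moreover have "(\<exists>z. y = x + z\<^sup>2) \<longleftrightarrow> x \<le> y" for x y :: real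
  proof
    assume "x \<le> y"
    hence "y = x + (sqrt (y - x))\<^sup>2" by simp
    thus "\<exists>z. y = x + z\<^sup>2" ..
  qed auto
  ultimately show "dpred 2 (\<lambda>xs. xs ! 0 \<le> xs ! 1)" by simp
qed

lemma dpred_less: "dterm n s \<Longrightarrow> dterm n t \<Longrightarrow> dpred n (\<lambda>xs. s xs < t xs)"
  using dpred_not[OF dpred_le] by (simp add: not_le)

lemmas dpred_intros = dpred_not dpred_and dpred_or dpred_imp dpred_True dpred_ex dpred_all
  dpred_eq dpred_le dpred_less
  dterm_nth dterm_const dterm_add dterm_mult dterm_uminus dterm_diff dterm_power2

lemma definable_function_iff: "definable_function S f \<longleftrightarrow> dpred 2 (\<lambda>xs. xs ! 1 = f (xs ! 0))"
proof -
  have "{xs. length xs = 2 \<and> xs ! 1 = f (xs ! 0)} = {[t, f t] |t. True}"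
    by (auto simp: length_Suc_conv eval_nat_numeral)
  thus ?thesis by (simp add: dpred_def definable_function_def)
qed

lemma definable_planar_iff: "definable_planar S X \<longleftrightarrow> dpred 2 (\<lambda>xs. (xs ! 0, xs ! 1) \<in> X)"
proof -
  have "{xs. length xs = 2 \<and> (xs ! 0, xs ! 1) \<in> X} = {[x, y] |x y. (x, y) \<in> X}"
    by (auto simp: length_Suc_conv eval_nat_numeral)
  thus ?thesis by (simp add: dpred_def definable_planar_def)
qed

lemma dterm_fun: "definable_function S f \<Longrightarrow> dterm n t \<Longrightarrow> dterm n (\<lambda>xs. f (t xs))"
  unfolding definable_function_iff by (rule dterm_if_graph)

lemma dpred_planar:
  "definable_planar S X \<Longrightarrow> dterm n s \<Longrightarrow> dterm n t \<Longrightarrow> dpred n (\<lambda>xs. (s xs, t xs) \<in> X)"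
  unfolding definable_planar_iff by (rule dpred_comp2)

lemma dterm_inverse: 
  assumes "dterm n t" shows "dterm n (\<lambda>xs. inverse (t xs))"
proof (rule dterm_if_graph[OF _ assms])
  \<comment> \<open>The first disjunct encodes the convention that \<open>inverse 0\<close> is
    0.\<close>
  have "dpred 2 (\<lambda>xs. (xs ! 0 = 0 \<and> xs ! 1 = 0) \<or> xs ! 0 * xs ! 1 = 1)"
    by (intro dpred_intros; simp)
  thus "dpred 2 (\<lambda>xs. xs ! 1 = inverse (xs ! 0))"
    by (rule dpred_cong) (metis inverse_unique inverse_zero mult_zero_left right_inverse zero_neq_one)
qed

lemma dterm_abs: 
  assumes "dterm n t" shows "dterm n (\<lambda>xs. \<bar>t xs\<bar>)"
proof (rule dterm_if_graph[OF _ assms])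
  have "dpred 2 (\<lambda>xs. 0 \<le> xs ! 1 \<and> (xs ! 1 = xs ! 0 \<or> xs ! 1 = - xs ! 0))"
    by (intro dpred_intros; simp)
  thus "dpred 2 (\<lambda>xs. xs ! 1 = \<bar>xs ! 0\<bar>)"
    by (rule dpred_cong) auto
qed

lemma definable_function_Sup:
  assumes "dpred 2 (\<lambda>xs. A (xs ! 0) (xs ! 1))"
  shows "definable_function S (\<lambda>x. total_Sup {y. A x y})"
proof -
  note A = dpred_comp2[OF assms]
  \<comment> \<open>The formula of \<open>total_Sup_eq_iff\<close>, with the conditional written as
    two implications.\<close>
  have "dpred 2 (\<lambda>xs. ((\<exists>y. A (xs ! 0) y) \<and> (\<exists>b. \<forall>y. A (xs ! 0) y \<longrightarrow> y \<le> b) \<longrightarrow>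
     (\<forall>y. A (xs ! 0) y \<longrightarrow> y \<le> xs ! 1) \<and> (\<forall>b. (\<forall>y. A (xs ! 0) y \<longrightarrow> y \<le> b) \<longrightarrow> xs ! 1 \<le> b)) \<and>
     (\<not> ((\<exists>y. A (xs ! 0) y) \<and> (\<exists>b. \<forall>y. A (xs ! 0) y \<longrightarrow> y \<le> b)) \<longrightarrow> xs ! 1 = 0))"
    by (intro dpred_intros A; simp add: dterm_nth)
  thus ?thesis unfolding definable_function_iff
    by (rule dpred_cong)
       (simp only: eq_commute[of _ "total_Sup _"] total_Sup_eq_iff mem_Collect_eq if_bool_eq_conj)
qed

text \<open>By o-minimality the truth set is a finite union of intervals, and membership in each
  interval settles on either side of \<open>a\<close>.\<close>

lemma definable_eventually:
  assumes "dpred 1 (\<lambda>xs. P (xs ! 0))"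
  shows "(\<forall>\<^sub>F x in at_right a. P x) \<or> (\<forall>\<^sub>F x in at_right a. \<not> P x)"
    and "(\<forall>\<^sub>F x in at_left a. P x) \<or> (\<forall>\<^sub>F x in at_left a. \<not> P x)"
proof -
  obtain F where F: "finite F" "\<forall>I\<in>F. is_interval I" "{xs. length xs = 1 \<and> P (xs ! 0)} = (\<lambda>x. [x]) ` (\<Union>F)"
    using assms unfolding dpred_def o_minimal by blast
  have "P x \<longleftrightarrow> [x] \<in> (\<lambda>x. [x]) ` (\<Union>F)" for x unfolding F(3)[symmetric] by simp
  hence P: "P x \<longleftrightarrow> x \<in> \<Union>F" for x by blast
  show "(\<forall>\<^sub>F x in at_right a. P x) \<or> (\<forall>\<^sub>F x in at_right a. \<not> P x)"
    and "(\<forall>\<^sub>F x in at_left a. P x) \<or> (\<forall>\<^sub>F x in at_left a. \<not> P x)"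
    unfolding P by (intro Union_dichotomy F is_interval_dichotomy F(2)[rule_format]; assumption)+
qed

end

subsection \<open>Second differences\<close>

text \<open>Boundedness gives a cluster point by compactness. If the values did not eventually stay
  within \<open>e\<close> of it, the dichotomy would keep them eventually away from it, against
  clustering.\<close>

lemma tendsto_if_eventually_dichotomy:
  fixes f :: "real \<Rightarrow> real"
  assumes "F \<noteq> bot" "\<forall>\<^sub>F x in F. \<bar>f x\<bar> \<le> B"
    and dich: "\<And>L e. (\<forall>\<^sub>F x in F. \<bar>f x - L\<bar> < e) \<or> (\<forall>\<^sub>F x in F. \<not> \<bar>f x - L\<bar> < e)"
  shows "\<exists>L. (f \<longlongrightarrow> L) F"
proof -
  have "filtermap f F \<noteq> bot" "\<forall>\<^sub>F y in filtermap f F. y \<in> {-B..B}"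
    using assms by (auto simp: filtermap_bot_iff eventually_filtermap abs_le_iff elim: eventually_mono)
  then obtain L where L: "inf (nhds L) (filtermap f F) \<noteq> bot"
    using compact_filter[of "{-B..B}"] by auto
  have "\<forall>\<^sub>F x in F. dist (f x) L < e" if "e > 0" for e
  proof (rule ccontr)
    assume "\<not> ?thesis"
    hence "\<forall>\<^sub>F y in filtermap f F. \<not> \<bar>y - L\<bar> < e"
      using dich[of L e] by (auto simp: dist_real_def eventually_filtermap)
    moreover have "\<forall>\<^sub>F y in nhds L. \<bar>y - L\<bar> < e"
      using that by (auto simp: eventually_nhds_metric dist_real_def)
    ultimately have "\<forall>\<^sub>F y in inf (nhds L) (filtermap f F). False"
      unfolding eventually_inf by blast
    thus False using L by (simp add: trivial_limit_def)
  qed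
  thus ?thesis by (auto simp: tendsto_iff)
qed

text \<open>\<open>E r\<close> collects the points with oscillation at least \<open>r\<close>. For
  \<open>r > 0\<close>, one-sided limits keep \<open>E r\<close> out of a punctured neighbourhood of
  every point, so it is sparse and hence countable within the interval; countably many of these sets
  cover the discontinuities.\<close>

lemma countable_discontinuities:
  fixes f :: "real \<Rightarrow> real"
  assumes right: "\<And>x. x \<in> {a<..<b} \<Longrightarrow> \<exists>L. (f \<longlongrightarrow> L) (at_right x)"
    and left: "\<And>x. x \<in> {a<..<b} \<Longrightarrow> \<exists>L. (f \<longlongrightarrow> L) (at_left x)"
  shows "countable {x \<in> {a<..<b}. \<not> isCont f x}"
proof -
  define E where "E r = {x. \<forall>d>0. \<exists>y z. \<bar>y - x\<bar> < d \<and> \<bar>z - x\<bar> < d \<and> \<bar>f y - f z\<bar> \<ge> r}" for r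
  have E: "y \<notin> E r" if "u < y" "y < v" and f: "\<And>z. u < z \<Longrightarrow> z < v \<Longrightarrow> dist (f z) L < r / 2" for u v y L r
  proof
    assume "y \<in> E r"
    moreover have "min (y - u) (v - y) > 0" using that by simp
    ultimately obtain w z where wz: "\<bar>w - y\<bar> < min (y - u) (v - y)" "\<bar>z - y\<bar> < min (y - u) (v - y)"
      "\<bar>f w - f z\<bar> \<ge> r" unfolding E_def by blast
    have "dist (f w) L < r / 2" "dist (f z) L < r / 2"
      by (rule f; use wz in \<open>simp add: abs_less_iff\<close>)+
    thus False using wz(3) unfolding dist_real_def by arith
  qed
  have "E r sparse_in {a<..<b}" if "r > 0" for r
    unfolding sparse_in_eventually_iff[OF open_greaterThanLessThan] eventually_at_split
  proof (intro ballI conjI)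
    fix x assume x: "x \<in> {a<..<b}"
    obtain L where "(f \<longlongrightarrow> L) (at_right x)" using right[OF x] by blast
    hence "\<forall>\<^sub>F y in at_right x. dist (f y) L < r / 2" by (rule tendstoD) (use that in simp)
    thus "\<forall>\<^sub>F y in at_right x. y \<notin> E r" unfolding eventually_at_right_field using E by meson
    obtain L where "(f \<longlongrightarrow> L) (at_left x)" using left[OF x] by blast
    hence "\<forall>\<^sub>F y in at_left x. dist (f y) L < r / 2" by (rule tendstoD) (use that in simp)
    thus "\<forall>\<^sub>F y in at_left x. y \<notin> E r" unfolding eventually_at_left_field using E by meson
  qed
  hence "countable (\<Union>n. {a<..<b} \<inter> E (inverse (real (Suc n))))"
    by (intro countable_UN sparse_imp_countable) auto
  moreover have "{x \<in> {a<..<b}. \<not> isCont f x} \<subseteq> (\<Union>n. {a<..<b} \<inter> E (inverse (real (Suc n))))"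
  proof
    fix x assume "x \<in> {x \<in> {a<..<b}. \<not> isCont f x}"
    hence x: "x \<in> {a<..<b}" "\<not> isCont f x" by auto
    then obtain e where e: "e > 0" "\<And>d. d > 0 \<Longrightarrow> \<exists>y. dist y x < d \<and> \<not> dist (f y) (f x) < e"
      unfolding continuous_at_eps_delta by (auto simp: dist_real_def)
    obtain n where n: "inverse (real (Suc n)) < e" using reals_Archimedean[OF e(1)] by blast
    have "x \<in> E (inverse (real (Suc n)))" unfolding E_def
    proof safe
      fix d :: real assume "d > 0"
      then obtain y where "dist y x < d" "\<not> dist (f y) (f x) < e" using e(2) by blast
      thus "\<exists>y z. \<bar>y - x\<bar> < d \<and> \<bar>z - x\<bar> < d \<and> inverse (real (Suc n)) \<le> \<bar>f y - f z\<bar>"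
        using n \<open>d > 0\<close> by (intro exI[of _ y] exI[of _ x]) (auto simp: dist_real_def)
    qed
    thus "x \<in> (\<Union>n. {a<..<b} \<inter> E (inverse (real (Suc n))))" using x by blast
  qed
  ultimately show ?thesis using countable_subset by blast
qed

definition second_difference :: "(real \<Rightarrow> real) \<Rightarrow> real \<Rightarrow> real \<Rightarrow> real" where
  "second_difference f x t = f (x + t) + f (x - t) - 2 * f x"

lemma eventually_bounded_if_quadratic:
  fixes f :: "real \<Rightarrow> real"
  assumes "\<forall>\<^sub>F x in at_right 0. \<bar>f x\<bar> \<le> c * x\<^sup>2"
  shows "\<forall>\<^sub>F x in at_right 0. \<bar>f x\<bar> \<le> \<bar>c\<bar>"
proof -
  have "\<forall>\<^sub>F x::real in at_right 0. 0 < x \<and> x < 1"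
    by (auto simp: eventually_at_right_field intro!: exI[of _ 1])
  with assms show ?thesis
  proof eventually_elim
    case (elim x)
    have "c * x\<^sup>2 \<le> \<bar>c\<bar> * 1" using elim by (intro mult_mono) (auto simp: power_le_one)
    thus ?case using elim by simp
  qed
qed

text \<open>Otherwise subtracting the chord and a slightly larger parabola from \<open>f\<close> produces an
  interior minimum with negative second differences.\<close>
lemma midpoint_lower_bound:
  fixes f :: "real \<Rightarrow> real"
  assumes "a < b" "continuous_on {a..b} f"
    and sd: "\<And>x. a < x \<Longrightarrow> x < b \<Longrightarrow> \<forall>\<^sub>F t in at_right 0. second_difference f x t \<le> K * t\<^sup>2"
  shows "(f a + f b) / 2 - K / 8 * (b - a)\<^sup>2 \<le> f ((a + b) / 2)"
proof (rule ccontr)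
  assume neg: "\<not> ?thesis"
  define q where "q = (f a + f b) / 2 - K / 8 * (b - a)\<^sup>2 - f ((a + b) / 2)"
  have q: "q > 0" using neg by (simp add: q_def)
  define \<eta> where "\<eta> = 2 * q / (b - a)\<^sup>2"
  have \<eta>: "\<eta> > 0" "\<eta> * (b - a)\<^sup>2 = 2 * q" using q \<open>a < b\<close> by (simp_all add: \<eta>_def)
  define s where "s = (f b - f a) / (b - a)"
  have s: "s * (b - a) = f b - f a" using \<open>a < b\<close> by (simp add: s_def)
  \<comment> \<open>The extra \<open>\<eta>\<close> costs only half of \<open>q\<close>:
    \<open>v\<close> is still \<open>- q / 2\<close> at the midpoint, while its second differences
    are at most \<open>- 2 * \<eta> * t\<^sup>2\<close> for small \<open>t\<close>.\<close>
  define v where "v x = f x - f a - s * (x - a) - (K / 2 + \<eta>) * ((x - a) * (x - b))" for x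
  have va: "v a = 0" and vb: "v b = 0" using s by (simp_all add: v_def)
  have "(a + b) / 2 - a = (b - a) / 2" "(a + b) / 2 - b = - ((b - a) / 2)" by (simp_all add: field_simps)
  hence "v ((a + b) / 2) = f ((a + b) / 2) - f a - s * (b - a) / 2 + (K / 2 + \<eta>) * ((b - a)\<^sup>2 / 4)"
    unfolding v_def by (simp add: power2_eq_square)
  also have "\<dots> = - q + \<eta> * (b - a)\<^sup>2 / 4" unfolding s q_def by (simp add: field_simps)
  also have "\<dots> < 0" using \<eta> q by simp
  finally have vm: "v ((a + b) / 2) < 0" .
  have "continuous_on {a..b} v" unfolding v_def by (intro continuous_intros assms)
  then obtain x where x: "x \<in> {a..b}" and min: "\<And>y. y \<in> {a..b} \<Longrightarrow> v x \<le> v y"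
    using continuous_attains_inf[of "{a..b}" v] \<open>a < b\<close> by auto
  have "v x < 0" using min[of "(a + b) / 2"] vm \<open>a < b\<close> by simp
  hence ax: "a < x" "x < b" using x va vb by (auto simp: less_le)
  have "\<forall>\<^sub>F t in at_right 0. t < min (x - a) (b - x) \<and> t > 0"
    using ax by (auto simp: eventually_at_right_field intro!: exI[of _ "min (x - a) (b - x)"])
  with sd[OF ax] have "\<forall>\<^sub>F t in at_right 0. second_difference f x t \<le> K * t\<^sup>2 \<and> t < min (x - a) (b - x) \<and> t > 0"
    by (rule eventually_conj)
  then obtain t where t: "second_difference f x t \<le> K * t\<^sup>2" "t < min (x - a) (b - x)" "t > 0"
    using eventually_happens'[of "at_right (0::real)"] by auto
  have "v (x + t) + v (x - t) - 2 * v x = second_difference f x t - (K + 2 * \<eta>) * t\<^sup>2"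
    unfolding v_def second_difference_def by (simp add: algebra_simps power2_eq_square)
  also have "\<dots> \<le> - (2 * \<eta> * t\<^sup>2)" using t(1) by (simp add: algebra_simps)
  also have "\<dots> < 0" using \<eta> t by simp
  finally show False using min[of "x + t"] min[of "x - t"] t by simp
qed

text \<open>\<open>h\<close> is the upper end of the highest gap in \<open>Y\<close>, and
  \<open>k\<close> its lower end. Were \<open>Y\<close> to fill a left neighbourhood of
  \<open>h\<close>, no member of \<open>G\<close> could lie just below \<open>h\<close>; the
  dichotomy therefore leaves a whole interval free of \<open>Y\<close> there. The last three
  conclusions justify replacing \<open>Sup\<close> by \<open>total_Sup\<close>.\<close>

lemma topmost_gap:
  fixes Y :: "real set"
  defines "G \<equiv> {u. u \<notin> Y \<and> (\<exists>y. y \<in> Y \<and> y < u) \<and> (\<exists>y. y \<in> Y \<and> u < y)}"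
  defines "h \<equiv> Sup G"
  defines "k \<equiv> Sup {y. y \<in> Y \<and> y < h}"
  assumes "closed Y" "bdd_above Y" "G \<noteq> {}"
    and dich: "\<And>x. (\<forall>\<^sub>F y in at_left x. y \<in> Y) \<or> (\<forall>\<^sub>F y in at_left x. y \<notin> Y)"
  shows "h \<in> Y" "k \<in> Y" "k < h" "\<And>y. k < y \<Longrightarrow> y < h \<Longrightarrow> y \<notin> Y"
    "bdd_above G" "\<exists>y. y \<in> Y \<and> y < h" "bdd_above {y. y \<in> Y \<and> y < h}"
proof -
  obtain B where B: "\<And>y. y \<in> Y \<Longrightarrow> y \<le> B" using \<open>bdd_above Y\<close> by (auto simp: bdd_above_def)
  show bG: "bdd_above G" unfolding bdd_above_def G_def using B by (force intro!: exI[of _ B])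
  have le_h: "u \<le> h" if "u \<in> G" for u using cSup_upper[OF that bG] by (simp add: h_def)
  obtain u0 where u0: "u0 \<in> G" using \<open>G \<noteq> {}\<close> by blast
  then obtain y1 where y1: "y1 \<in> Y" "y1 < u0" by (auto simp: G_def)
  show ex: "\<exists>y. y \<in> Y \<and> y < h" using y1 le_h[OF u0] by force
  show bk: "bdd_above {y. y \<in> Y \<and> y < h}" by (auto simp: bdd_above_def intro!: exI[of _ h])
  show h: "h \<in> Y"
  proof (rule ccontr)
    assume "h \<notin> Y"
    then obtain d where d: "d > 0" "\<And>y. dist y h < d \<Longrightarrow> y \<notin> Y"
      using \<open>closed Y\<close> unfolding closed_def open_dist by (auto simp: Ball_def)
    obtain u where u: "u \<in> G" "h - d < u" using less_cSupE[of "h - d" G] \<open>G \<noteq> {}\<close> d(1) by (auto simp: h_def)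
    then obtain y2 where y2: "y2 \<in> Y" "u < y2" by (auto simp: G_def)
    have "y2 \<ge> h + d" using d(2)[of y2] y2 u(2) by (force simp: dist_real_def)
    moreover have "h + d / 2 \<notin> Y" using d by (simp add: dist_real_def)
    moreover have "y1 < h + d / 2" using y1 le_h[OF u0] d(1) by simp
    moreover have "h + d / 2 < h + d" using d(1) by simp
    \<comment> \<open>A hole around \<open>h\<close> belongs to the gap on both sides, so
      \<open>G\<close> would have a member above its supremum.\<close>
    ultimately have "h + d / 2 \<in> G" unfolding G_def using y1 y2 by (blast intro: less_le_trans)
    thus False using le_h d(1) by force
  qed
  have "\<forall>\<^sub>F y in at_left h. y \<notin> Y"
  proof -
    have "\<not> (\<forall>\<^sub>F y in at_left h. y \<in> Y)"
    proof
      assume "\<forall>\<^sub>F y in at_left h. y \<in> Y"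
      then obtain b where b: "b < h" "\<And>y. b < y \<Longrightarrow> y < h \<Longrightarrow> y \<in> Y" by (auto simp: eventually_at_left_field)
      obtain u where u: "u \<in> G" "b < u" using less_cSupE[of b G] \<open>G \<noteq> {}\<close> b(1) by (auto simp: h_def)
      have "u \<noteq> h" using h u by (auto simp: G_def)
      with le_h[OF u(1)] b(2)[of u] u show False by (auto simp: G_def)
    qed
    thus ?thesis using dich by blast
  qed
  then obtain b where b: "b < h" "\<And>y. b < y \<Longrightarrow> y < h \<Longrightarrow> y \<notin> Y" by (auto simp: eventually_at_left_field)
  have "k \<le> b" unfolding k_def by (rule cSup_least) (use ex b(2) in \<open>force+\<close>)
  thus kh: "k < h" using b by simp
  show "y \<notin> Y" if "k < y" "y < h" for y
    using cSup_upper[of y "{y. y \<in> Y \<and> y < h}"] bk that unfolding k_def by force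
  have "k \<in> closure {y. y \<in> Y \<and> y < h}" unfolding k_def by (rule closure_contains_Sup) (use ex bk in auto)
  also have "\<dots> \<subseteq> Y" by (rule closure_minimal) (use \<open>closed Y\<close> in auto)
  finally show "k \<in> Y" .
qed

section \<open>Eventual regularity of definable functions\<close>

context o_minimal_structure
begin

lemmas definable_intros = dpred_intros dterm_abs dterm_inverse

text \<open>A weak substitute for the monotonicity theorem. Otherwise continuity would fail at all
  small \<open>x > 0\<close>, whereas the dichotomies give one-sided limits there and hence only
  countably many discontinuities.\<close>

lemma definable_eventually_isCont:
  assumes f: "definable_function S f"
    and "\<forall>\<^sub>F x in at_right 0. \<bar>f x\<bar> \<le> B"
  shows "\<forall>\<^sub>F x in at_right 0. isCont f x"
proof (rule ccontr)
  assume neg: "\<not> ?thesis"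
  \<comment> \<open>The epsilon-delta form makes continuity a first-order condition.\<close>
  have iff: "isCont f x \<longleftrightarrow> (\<forall>e. 0 < e \<longrightarrow> (\<exists>d. 0 < d \<and> (\<forall>y. \<bar>y - x\<bar> < d \<longrightarrow> \<bar>f y - f x\<bar> < e)))" for x
    unfolding continuous_at_eps_delta by (auto simp: dist_real_def)
  have "dpred 1 (\<lambda>xs. isCont f (xs ! 0))"
    unfolding iff by (intro definable_intros dterm_fun[OF f]; simp add: dterm_nth)
  from definable_eventually(1)[OF this] neg have "\<forall>\<^sub>F x in at_right 0. \<not> isCont f x" by blast
  with assms(2) have "\<forall>\<^sub>F x in at_right 0. \<bar>f x\<bar> \<le> B \<and> \<not> isCont f x" by eventually_elim simp
  then obtain a where a: "a > 0" "\<And>x. 0 < x \<Longrightarrow> x < a \<Longrightarrow> \<bar>f x\<bar> \<le> B \<and> \<not> isCont f x"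
    by (auto simp: eventually_at_right_field)
  have "dpred 1 (\<lambda>xs. \<bar>f (xs ! 0) - L\<bar> < e)" for L e
    by (intro definable_intros dterm_fun[OF f]; simp add: dterm_nth)
  note dich = definable_eventually[OF this]
  have "countable {x \<in> {0<..<a}. \<not> isCont f x}"
  proof (rule countable_discontinuities)
    fix x assume x: "x \<in> {0<..<a}"
    show "\<exists>L. (f \<longlongrightarrow> L) (at_right x)"
      by (rule tendsto_if_eventually_dichotomy[of _ _ B]; (rule dich)?)
         (use x a in \<open>auto simp: eventually_at_right_field intro!: exI[of _ a]\<close>)
    show "\<exists>L. (f \<longlongrightarrow> L) (at_left x)"
      by (rule tendsto_if_eventually_dichotomy[of _ _ B]; (rule dich)?)
         (use x a in \<open>auto simp: eventually_at_left_field intro!: exI[of _ 0]\<close>)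
  qed
  moreover have "{x \<in> {0<..<a}. \<not> isCont f x} = {0<..<a}" using a by auto
  ultimately show False using a(1) by (metis uncountable_open_interval)
qed

text \<open>If the second differences at small \<open>x\<close> were not bounded by \<open>(18 c + 1) t\<^sup>2\<close>, they would
  all exceed it, and the midpoint inequality on \<open>[x, 3x]\<close> would contradict \<open>\<bar>f x\<bar> \<le> c x\<^sup>2\<close>.\<close>
lemma definable_second_difference_bound:
  assumes f: "definable_function S f"
    and bd: "\<forall>\<^sub>F x in at_right 0. \<bar>f x\<bar> \<le> c * x\<^sup>2"
  shows "\<forall>\<^sub>F x in at_right 0. \<forall>\<^sub>F t in at_right 0. second_difference f x t \<le> (18 * c + 1) * t\<^sup>2"
proof (rule ccontr)
  assume neg: "\<not> ?thesis"
  \<comment> \<open>18 is 1 + 9 + 2 * 4, from the bounds on \<bar>f\<bar> at \<open>x\<close>, at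
    \<open>3 * x\<close> and twice at \<open>2 * x\<close>; the added 1 produces the
    contradiction.\<close>
  define K where "K = 18 * c + 1"
  have iff: "(\<forall>\<^sub>F t in at_right 0. second_difference f x t \<le> K * t\<^sup>2) \<longleftrightarrow>
    (\<exists>b. 0 < b \<and> (\<forall>t. 0 < t \<longrightarrow> t < b \<longrightarrow> f (x + t) + f (x - t) - 2 * f x \<le> K * t\<^sup>2))" for x
    unfolding eventually_at_right_field second_difference_def by auto
  have "dpred 1 (\<lambda>xs. \<forall>\<^sub>F t in at_right 0. second_difference f (xs ! 0) t \<le> K * t\<^sup>2)"
    unfolding iff by (intro definable_intros dterm_fun[OF f]; simp add: dterm_nth)
  from definable_eventually(1)[OF this] neg
  have neg': "\<forall>\<^sub>F x in at_right 0. \<not> (\<forall>\<^sub>F t in at_right 0. second_difference f x t \<le> K * t\<^sup>2)"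
    unfolding K_def by blast
  have "dpred 1 (\<lambda>ts. second_difference f x (ts ! 0) \<le> K * (ts ! 0)\<^sup>2)" for x
    unfolding second_difference_def by (intro definable_intros dterm_fun[OF f]; simp add: dterm_nth)
  note dich = definable_eventually(1)[OF this]
  note cont = definable_eventually_isCont[OF f eventually_bounded_if_quadratic[OF bd]]
  from neg' cont bd have "\<forall>\<^sub>F x in at_right 0. isCont f x \<and> \<bar>f x\<bar> \<le> c * x\<^sup>2 \<and>
      (\<forall>\<^sub>F t in at_right 0. \<not> second_difference f x t \<le> K * t\<^sup>2)"
    by eventually_elim (use dich in blast)
  then obtain a where a: "a > 0" "\<And>x. 0 < x \<Longrightarrow> x < a \<Longrightarrow> isCont f x \<and> \<bar>f x\<bar> \<le> c * x\<^sup>2 \<and>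
      (\<forall>\<^sub>F t in at_right 0. \<not> second_difference f x t \<le> K * t\<^sup>2)"
    by (auto simp: eventually_at_right_field)
  define x where "x = a / 4"
  have x: "x > 0" "3 * x < a" using a(1) by (simp_all add: x_def)
  \<comment> \<open>Applied to \<open>- f\<close> with \<open>- K\<close>, since here the second
    differences of \<open>f\<close> are bounded from below.\<close>
  have "((- f x) + (- f (3 * x))) / 2 - (- K) / 8 * (3 * x - x)\<^sup>2 \<le> - f ((x + 3 * x) / 2)"
  proof (rule midpoint_lower_bound)
    show "continuous_on {x..3 * x} (\<lambda>x. - f x)"
      using a x by (intro continuous_at_imp_continuous_on ballI continuous_minus) auto
    fix y assume "x < y" "y < 3 * x"
    hence "\<forall>\<^sub>F t in at_right 0. \<not> second_difference f y t \<le> K * t\<^sup>2" using a(2)[of y] x by auto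
    thus "\<forall>\<^sub>F t in at_right 0. second_difference (\<lambda>x. - f x) y t \<le> - K * t\<^sup>2"
      by eventually_elim (simp add: second_difference_def)
  qed (use x in auto)
  hence "K * x\<^sup>2 \<le> f x + f (3 * x) - 2 * f (2 * x)"
    by (simp add: power2_eq_square field_simps)
  moreover have "\<bar>f x\<bar> \<le> c * x\<^sup>2" using a(2)[of x] x by simp
  moreover have "\<bar>f (3 * x)\<bar> \<le> 9 * (c * x\<^sup>2)" using a(2)[of "3 * x"] x by (simp add: power_mult_distrib)
  moreover have "\<bar>f (2 * x)\<bar> \<le> 4 * (c * x\<^sup>2)" using a(2)[of "2 * x"] x by (simp add: power_mult_distrib)
  ultimately have "K * x\<^sup>2 \<le> 18 * (c * x\<^sup>2)" by linarith
  hence "x\<^sup>2 \<le> 0" by (simp add: K_def algebra_simps)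
  thus False using x by simp
qed

end

section \<open>Gluing the two sides of the origin\<close>

definition tame :: "real \<Rightarrow> (real \<Rightarrow> real) \<Rightarrow> real \<Rightarrow> bool" where
  "tame c u x \<longleftrightarrow> isCont u x \<and> \<bar>u x\<bar> \<le> c * x\<^sup>2 \<and>
     (\<forall>\<^sub>F t in at_right 0. second_difference u x t \<le> (18 * c + 1) * t\<^sup>2)"

lemma tame_zero: "c \<ge> 0 \<Longrightarrow> tame c (\<lambda>_. 0) x"
  by (simp add: tame_def second_difference_def)

text \<open>The left branch comes from the mirror image, hence \<open>v (- x)\<close>. The type is
  polymorphic so that the condition for a nonempty fibre can be glued as well.\<close>

definition glue :: "(real \<Rightarrow> 'a) \<Rightarrow> 'a \<Rightarrow> (real \<Rightarrow> 'a) \<Rightarrow> real \<Rightarrow> 'a" where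
  "glue v z u x = (if x > 0 then u x else if x < 0 then v (- x) else z)"

text \<open>Away from 0 only one branch is seen locally, and second differences are unchanged by
  reflection. At 0 the bound \<open>c * x\<^sup>2\<close> alone gives continuity and a second
  difference of at most \<open>2 * c * t\<^sup>2\<close>.\<close>

lemma tame_glue:
  assumes "c \<ge> 0" "\<And>x. 0 < x \<Longrightarrow> x < e \<Longrightarrow> tame c u x" "\<And>x. 0 < x \<Longrightarrow> x < e \<Longrightarrow> tame c v x"
    and "\<bar>x\<bar> < e"
  shows "tame c (glue v 0 u) x"
proof -
  have bd: "\<bar>glue v 0 u y\<bar> \<le> c * y\<^sup>2" if "\<bar>y\<bar> < e" for y
    using that assms(2)[of y] assms(3)[of "- y"] by (auto simp: glue_def tame_def)
  have small: "\<forall>\<^sub>F t in at_right 0. 0 < t \<and> t < b" if "b > 0" for b :: real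
    using that by (auto simp: eventually_at_right_field)
  consider "x > 0" | "x < 0" | "x = 0" by linarith
  thus ?thesis
  proof cases
    case 1
    have u: "tame c u x" using 1 assms by simp
    have "\<forall>\<^sub>F y in nhds x. glue v 0 u y = u y"
      using eventually_nhds_in_open[of "{0<..}" x] 1 by (auto simp: glue_def elim: eventually_mono)
    from isCont_cong[OF this] have "isCont (glue v 0 u) x" using u by (simp add: tame_def)
    moreover have "\<forall>\<^sub>F t in at_right 0. second_difference (glue v 0 u) x t \<le> (18 * c + 1) * t\<^sup>2"
      using small[OF 1] u[unfolded tame_def, THEN conjunct2, THEN conjunct2]
      by eventually_elim (use 1 in \<open>simp add: second_difference_def glue_def\<close>)
    ultimately show ?thesis using bd[of x] assms(4) by (simp add: tame_def)
  next
    case 2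
    have v: "tame c v (- x)" using 2 assms by simp
    have "\<forall>\<^sub>F y in nhds x. glue v 0 u y = v (- y)"
      using eventually_nhds_in_open[of "{..<0}" x] 2 by (auto simp: glue_def elim: eventually_mono)
    note cong = isCont_cong[OF this]
    have "isCont (\<lambda>y. v (- y)) x"
      by (rule isCont_o2[where g = v]) (use v in \<open>simp_all add: tame_def\<close>)
    hence "isCont (glue v 0 u) x" using cong by blast
    moreover have "0 < - x" using 2 by simp
    from small[OF this] v[unfolded tame_def, THEN conjunct2, THEN conjunct2]
    have "\<forall>\<^sub>F t in at_right 0. second_difference (glue v 0 u) x t \<le> (18 * c + 1) * t\<^sup>2"
    proof eventually_elim
      case (elim t)
      have "second_difference (glue v 0 u) x t = v (- x - t) + v (- x + t) - 2 * v (- x)"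
        using elim 2 by (simp add: second_difference_def glue_def)
      thus ?case using elim by (simp add: second_difference_def)
    qed
    ultimately show ?thesis using bd[of x] assms(4) by (simp add: tame_def)
  next
    case 3
    have "e > 0" using assms(4) by simp
    have "(glue v 0 u \<longlongrightarrow> 0) (at 0)"
    proof (rule tendsto_0_le[where K = 1])
      show "((\<lambda>y. c * y\<^sup>2) \<longlongrightarrow> 0) (at 0)" by (auto intro!: tendsto_eq_intros)
      have "\<forall>\<^sub>F y in at (0::real). \<bar>y\<bar> < e"
        using \<open>e > 0\<close> by (auto simp: eventually_at dist_real_def)
      thus "\<forall>\<^sub>F y in at 0. norm (glue v 0 u y) \<le> norm (c * y\<^sup>2) * 1"
        by eventually_elim (use bd assms(1) in \<open>simp add: abs_mult\<close>)
    qed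
    hence "isCont (glue v 0 u) x" unfolding isCont_def 3 by (simp add: glue_def)
    moreover have "\<forall>\<^sub>F t in at_right 0. second_difference (glue v 0 u) x t \<le> (18 * c + 1) * t\<^sup>2"
      using small[OF \<open>e > 0\<close>]
    proof eventually_elim
      case (elim t)
      have "\<bar>glue v 0 u t\<bar> \<le> c * t\<^sup>2" "\<bar>glue v 0 u (- t)\<bar> \<le> c * t\<^sup>2" using bd[of t] bd[of "- t"] elim by auto
      moreover have "0 \<le> c * t\<^sup>2" using assms(1) by simp
      ultimately have "glue v 0 u t + glue v 0 u (- t) \<le> 18 * (c * t\<^sup>2) + t\<^sup>2" by (smt (verit) zero_le_power2)
      thus ?case using 3 by (simp add: second_difference_def glue_def algebra_simps)
    qed
    ultimately show ?thesis using bd[of x] assms(4) by (simp add: tame_def)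
  qed
qed

lemma tame_midpoint:
  assumes "\<And>x. \<bar>x\<bar> < e \<Longrightarrow> tame c u x" "\<bar>a\<bar> < e" "\<bar>b\<bar> < e"
  shows "(u a + u b) / 2 - (18 * c + 1) / 8 * (b - a)\<^sup>2 \<le> u ((a + b) / 2)"
proof -
  have *: "(u a + u b) / 2 - (18 * c + 1) / 8 * (b - a)\<^sup>2 \<le> u ((a + b) / 2)"
    if "a < b" "\<bar>a\<bar> < e" "\<bar>b\<bar> < e" for a b
  proof (rule midpoint_lower_bound[OF that(1)])
    have t: "tame c u x" if "x \<in> {a..b}" for x
      by (rule assms(1)) (use that \<open>\<bar>a\<bar> < e\<close> \<open>\<bar>b\<bar> < e\<close> in \<open>auto simp: abs_less_iff\<close>)
    show "continuous_on {a..b} u"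
      by (intro continuous_at_imp_continuous_on ballI) (use t in \<open>auto simp: tame_def\<close>)
    show "\<forall>\<^sub>F t in at_right 0. second_difference u x t \<le> (18 * c + 1) * t\<^sup>2" if "a < x" "x < b" for x
      using t[of x] that by (auto simp: tame_def)
  qed
  consider "a < b" | "a = b" | "b < a" by linarith
  thus ?thesis
  proof cases
    case 3
    thus ?thesis using *[OF 3] assms by (simp add: add.commute power2_commute)
  qed (use *[of a b] assms in auto)
qed

text \<open>Parallelogram identity: for equidistant \<open>a\<close> and \<open>b\<close> the midpoint is closer to \<open>p\<close> by a
  quadratic amount, which a point of \<open>X\<close> that close to the midpoint contradicts.\<close>
lemma nearest_point_unique:
  fixes p a b q :: "'a :: real_inner"
  assumes "dist p a = d" "dist p b = d" "d \<le> dist p q" "K * d < 1" "K \<ge> 0"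
    and q: "dist q ((1/2) *\<^sub>R (a + b)) \<le> K / 8 * (dist a b)\<^sup>2"
  shows "a = b"
proof (rule ccontr)
  assume "a \<noteq> b"
  define s where "s = dist p ((1/2) *\<^sub>R (a + b))"
  have mid: "p - (1/2) *\<^sub>R (a + b) = (1/2) *\<^sub>R ((p - a) + (p - b))"
    by (simp add: algebra_simps flip: scaleR_2)
  have diff: "norm ((p - b) - (p - a)) = norm (a - b)" by simp
  have "(norm ((1/2) *\<^sub>R (v + w)))\<^sup>2 + (norm (w - v))\<^sup>2 / 4 = ((norm v)\<^sup>2 + (norm w)\<^sup>2) / 2" for v w :: 'a
    unfolding power2_norm_eq_inner by (simp add: inner_simps inner_commute field_simps)
  from this[of "p - a" "p - b"] mid diff have eq: "s\<^sup>2 + (dist a b)\<^sup>2 / 4 = d\<^sup>2"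
    using assms(1,2) unfolding s_def dist_norm by simp
  have s0: "s \<ge> 0" and d0: "d \<ge> 0" using assms(1) by (auto simp: s_def)
  have "(dist a b)\<^sup>2 > 0" using \<open>a \<noteq> b\<close> by simp
  hence "s\<^sup>2 < d\<^sup>2" using eq by linarith
  hence sd: "s < d" using d0 power2_less_imp_less by blast
  \<comment> \<open>The detour through the midpoint bounds \<open>d\<close>; eliminating
    \<open>dist a b\<close> makes \<open>d - s\<close> a common positive factor that
    cancels.\<close>
  have "d \<le> s + K / 8 * (dist a b)\<^sup>2"
    using assms(3) q dist_triangle[of p q "(1/2) *\<^sub>R (a + b)"] unfolding s_def by (simp add: dist_commute)
  also have "(dist a b)\<^sup>2 = 4 * (d\<^sup>2 - s\<^sup>2)" using eq by simp
  also have "s + K / 8 * (4 * (d\<^sup>2 - s\<^sup>2)) = s + (K * (d + s) / 2) * (d - s)"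
    by (simp add: power2_eq_square field_simps)
  finally have "1 * (d - s) \<le> (K * (d + s) / 2) * (d - s)" by simp
  hence "1 \<le> K * (d + s) / 2" using sd by (simp only: mult_le_cancel_right)
  moreover have "K * s \<le> K * d" using sd assms(5) by (intro mult_left_mono) auto
  ultimately show False using assms(4) by (simp add: algebra_simps)
qed

text \<open>Unlike components, clopen sets transfer to the mirror image of \<open>X\<close> by plain preimages.\<close>
definition clopen_filled :: "(real \<times> real) set \<Rightarrow> bool" where
  "clopen_filled X \<longleftrightarrow> (\<exists>r0>0. \<forall>r R. 0 < r \<longrightarrow> r < r0 \<longrightarrow> R \<noteq> {} \<longrightarrow> R \<subseteq> ball 0 (2 * r) - X \<longrightarrow> open R \<longrightarrow>
     closedin (top_of_set (ball 0 (2 * r) - X)) R \<longrightarrow> (0, r) \<in> R \<or> (0, - r) \<in> R)"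

text \<open>A relatively clopen set contains the whole component of each of its points, so it
  inherits the marked point of that component.\<close>

lemma filled_horizontally_imp_clopen_filled:
  assumes "filled_horizontally X"
  shows "clopen_filled X"
proof -
  obtain r0 where r0: "r0 > 0" "\<And>r C. 0 < r \<Longrightarrow> r < r0 \<Longrightarrow> C \<in> components (ball 0 (2 * r) - X) \<Longrightarrow>
      (0, r) \<in> C \<or> (0, - r) \<in> C"
    using assms unfolding filled_horizontally_def by blast
  have "(0, r) \<in> R \<or> (0, - r) \<in> R"
    if r: "0 < r" "r < r0" and "R \<noteq> {}" and R: "R \<subseteq> ball 0 (2 * r) - X" "open R"
      "closedin (top_of_set (ball 0 (2 * r) - X)) R" for r R
  proof -
    obtain p where p: "p \<in> R" using \<open>R \<noteq> {}\<close> by blast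
    define C where "C = connected_component_set (ball 0 (2 * r) - X) p"
    have C: "C \<in> components (ball 0 (2 * r) - X)" "connected C" "p \<in> C" "C \<subseteq> ball 0 (2 * r) - X"
      using p R(1) by (auto simp: C_def components_def connected_component_subset)
    have "openin (top_of_set C) (C \<inter> R)" using R(2) by (simp add: openin_open_Int)
    moreover have "closedin (top_of_set C) (C \<inter> R)"
    proof -
      obtain T where T: "closed T" "R = (ball 0 (2 * r) - X) \<inter> T" using R(3) by (auto simp: closedin_closed)
      hence "C \<inter> R = C \<inter> T" using C(4) by blast
      thus ?thesis using T(1) by (simp add: closedin_closed_Int)
    qed
    ultimately have "C \<inter> R = {} \<or> C \<inter> R = C" using C(2) by (auto simp: connected_clopen)
    hence "C \<subseteq> R" using p C(3) by blast
    thus ?thesis using r0(2)[OF r C(1)] by blast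
  qed
  thus ?thesis unfolding clopen_filled_def using r0(1) by blast
qed

lemma total_Sup_closed:
  assumes "closed A" "A \<noteq> {}" "bdd_above A"
  shows "total_Sup A \<in> A" "\<And>y. y \<in> A \<Longrightarrow> y \<le> total_Sup A"
  using closed_contains_Sup[OF assms(2,3,1)] cSup_upper[OF _ assms(3)] assms by (auto simp: total_Sup_def)

subsection \<open>Fibres of \<open>X\<close> and the quadratic bound\<close>

context o_minimal_structure
begin

lemma definable_tame:
  assumes "definable_function S u" "\<forall>\<^sub>F x in at_right 0. \<bar>u x\<bar> \<le> c * x\<^sup>2"
  shows "\<forall>\<^sub>F x in at_right 0. tame c u x"
  using definable_eventually_isCont[OF assms(1) eventually_bounded_if_quadratic[OF assms(2)]]
    definable_second_difference_bound[OF assms] assms(2)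
  by eventually_elim (simp add: tame_def)

text \<open>The lower edge is written \<open>- l\<close>, so that an upper bound on second
  differences serves both edges. The constant \<open>P\<close> records whether the fibres are
  nonempty.\<close>

lemma right_branch:
  assumes X: "definable_planar S X" "closed X" "(0, 0) \<in> X" and c: "c > 0"
    and filled: "clopen_filled X"
  shows "\<exists>l u P. \<forall>\<^sub>F x in at_right 0. tame c l x \<and> tame c u x \<and> - l x \<le> u x \<and>
    (\<forall>y. (x, y) \<in> X \<and> \<bar>y\<bar> \<le> c * x\<^sup>2 \<longleftrightarrow> P \<and> - l x \<le> y \<and> y \<le> u x)"
proof -
  \<comment> \<open>Truncation at \<open>c * x\<^sup>2\<close> makes the fibre compact and confines
    attention to the part of \<open>X\<close> near the origin.\<close>
  define Y where "Y x = {y. (x, y) \<in> X \<and> \<bar>y\<bar> \<le> c * x\<^sup>2}" for x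
  note XI = dpred_planar[OF X(1)]
  have Y: "dpred n (\<lambda>xs. t xs \<in> Y (s xs))" if "dterm n s" "dterm n t" for n s t
    unfolding Y_def mem_Collect_eq by (intro definable_intros XI that)
  have clY: "closed (Y x)" for x
  proof -
    have "closed ((\<lambda>y. (x, y)) -` X)" by (intro closed_vimage X continuous_intros)
    moreover have "closed {y. \<bar>y\<bar> \<le> c * x\<^sup>2}" by (intro closed_Collect_le continuous_intros)
    ultimately have "closed ((\<lambda>y. (x, y)) -` X \<inter> {y. \<bar>y\<bar> \<le> c * x\<^sup>2})" by (rule closed_Int)
    also have "(\<lambda>y. (x, y)) -` X \<inter> {y. \<bar>y\<bar> \<le> c * x\<^sup>2} = Y x" by (auto simp: Y_def)
    finally show ?thesis .
  qed
  have bdY: "\<bar>y\<bar> \<le> c * x\<^sup>2" if "y \<in> Y x" for x y using that by (simp add: Y_def)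
  have bddY: "bdd_above (Y x)" for x
    unfolding bdd_above_def using bdY by (meson abs_le_D1)
  have dichY: "(\<forall>\<^sub>F y in at_left z. y \<in> Y x) \<or> (\<forall>\<^sub>F y in at_left z. y \<notin> Y x)" for x z
    by (rule definable_eventually(2), rule Y) (intro definable_intros; simp)+
  define G where "G x = {u. u \<notin> Y x \<and> (\<exists>y. y \<in> Y x \<and> y < u) \<and> (\<exists>y. y \<in> Y x \<and> u < y)}" for x
  have "dpred 1 (\<lambda>xs. Y (xs ! 0) \<noteq> {})"
    unfolding ex_in_conv[symmetric] by (intro definable_intros Y; simp add: dterm_nth)
  from definable_eventually(1)[OF this, of 0]
  have dich1: "(\<forall>\<^sub>F x in at_right 0. Y x \<noteq> {}) \<or> (\<forall>\<^sub>F x in at_right 0. Y x = {})" by simp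
  have "dpred 1 (\<lambda>xs. G (xs ! 0) \<noteq> {})"
    unfolding ex_in_conv[symmetric] G_def mem_Collect_eq by (intro definable_intros Y; simp add: dterm_nth)
  from definable_eventually(1)[OF this, of 0]
  have dich2: "(\<forall>\<^sub>F x in at_right 0. G x \<noteq> {}) \<or> (\<forall>\<^sub>F x in at_right 0. G x = {})" by simp
  \<comment> \<open>The open region between the graphs of \<open>k\<close> and \<open>h\<close> lies
    over \<open>x > 0\<close> and is clopen in the ball minus \<open>X\<close>; it misses both
    marked points on the vertical axis, contrary to filling.\<close>
  have nogap: "\<not> (\<forall>\<^sub>F x in at_right 0. G x \<noteq> {})"
  proof
    assume gap: "\<forall>\<^sub>F x in at_right 0. G x \<noteq> {}"
    define h where "h x = total_Sup {u. u \<in> G x}" for x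
    define k where "k x = total_Sup {y. y \<in> Y x \<and> y < h x}" for x
    have defh: "definable_function S h" unfolding h_def
      unfolding G_def mem_Collect_eq by (intro definable_function_Sup definable_intros Y; simp add: dterm_nth)
    have defk: "definable_function S k" unfolding k_def
      by (intro definable_function_Sup definable_intros Y dterm_fun[OF defh]; simp add: dterm_nth)
    have hk: "h x \<in> Y x" "k x \<in> Y x" "k x < h x" "\<And>y. k x < y \<Longrightarrow> y < h x \<Longrightarrow> y \<notin> Y x" if "G x \<noteq> {}" for x
    proof -
      note gap = topmost_gap[OF clY bddY that[unfolded G_def] dichY, folded G_def]
      have h: "h x = Sup (G x)" using gap(5) that by (simp add: h_def total_Sup_def)
      have k: "k x = Sup {y. y \<in> Y x \<and> y < h x}" using gap(6,7) by (auto simp: k_def total_Sup_def h)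
      show "h x \<in> Y x" "k x \<in> Y x" "k x < h x" "\<And>y. k x < y \<Longrightarrow> y < h x \<Longrightarrow> y \<notin> Y x"
        using gap(1-4) unfolding k h by blast+
    qed
    have "\<forall>\<^sub>F x in at_right 0. \<bar>h x\<bar> \<le> c * x\<^sup>2" "\<forall>\<^sub>F x in at_right 0. \<bar>k x\<bar> \<le> c * x\<^sup>2"
      using gap by (eventually_elim; use hk bdY in blast)+
    from definable_tame[OF defh this(1)] definable_tame[OF defk this(2)] gap
    have "\<forall>\<^sub>F x in at_right 0. isCont h x \<and> isCont k x \<and> G x \<noteq> {}"
      by eventually_elim (simp add: tame_def)
    then obtain e where e: "e > 0" "\<And>x. 0 < x \<Longrightarrow> x < e \<Longrightarrow> isCont h x \<and> isCont k x \<and> G x \<noteq> {}"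
      by (auto simp: eventually_at_right_field)
    obtain r0 where r0: "r0 > 0" "\<And>r R. 0 < r \<Longrightarrow> r < r0 \<Longrightarrow> R \<noteq> {} \<Longrightarrow> R \<subseteq> ball 0 (2 * r) - X \<Longrightarrow>
      open R \<Longrightarrow> closedin (top_of_set (ball 0 (2 * r) - X)) R \<Longrightarrow> (0, r) \<in> R \<or> (0, - r) \<in> R"
      using filled unfolding clopen_filled_def by blast
    \<comment> \<open>\<open>2 * r < e\<close> keeps the right half of the ball over the interval
      where \<open>h\<close> and \<open>k\<close> are continuous.\<close>
    define r where "r = min (e / 3) (r0 / 2)"
    have r: "0 < r" "r < r0" "2 * r < e" using e(1) r0(1) by (auto simp: r_def)
    define R where "R = {(x, y). 0 < x \<and> x < e \<and> k x < y \<and> y < h x} \<inter> ball 0 (2 * r)"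
    have fst_less: "x < e" if "(x, y) \<in> ball 0 (2 * r)" for x y :: real
      using that r(3) norm_fst_le[of x y] by (simp add: abs_le_iff)
    have "(0, r) \<in> R \<or> (0, - r) \<in> R"
    proof (rule r0(2)[OF r(1,2)])
      \<comment> \<open>The bound \<open>1 / (2 * c)\<close> gives \<open>c * x\<^sup>2 < x\<close>,
        which places the point halfway up the gap inside the ball.\<close>
      define x where "x = min (r / 2) (1 / (2 * c))"
      have x: "0 < x" "x < r" "x < e" using r c by (auto simp: x_def)
      have "x * c \<le> 1 / (2 * c) * c" unfolding x_def using c by (intro mult_right_mono) auto
      hence xc: "x * c < 1" using c by simp
      define y where "y = (k x + h x) / 2"
      have y: "k x < y" "y < h x" using hk(3)[of x] e(2)[of x] x by (auto simp: y_def)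
      have "\<bar>h x\<bar> \<le> c * x\<^sup>2" "\<bar>k x\<bar> \<le> c * x\<^sup>2" using hk(1,2)[of x] e(2)[of x] x bdY by auto
      hence "\<bar>y\<bar> \<le> c * x\<^sup>2" using y by (simp add: abs_le_iff)
      also have "\<dots> = (x * c) * x" by (simp add: power2_eq_square)
      also have "\<dots> < 1 * r" using x xc by (intro mult_strict_mono) auto
      finally have "norm (x, y) < 2 * r" using norm_Pair_le[of x y] x by simp
      hence "(x, y) \<in> R" using x y by (simp add: R_def)
      thus "R \<noteq> {}" by blast
      show "R \<subseteq> ball 0 (2 * r) - X"
      proof safe
        fix x y assume "(x, y) \<in> R" "(x, y) \<in> X"
        hence x: "0 < x" "x < e" "k x < y" "y < h x" "(x, y) \<in> X" by (auto simp: R_def)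
        have "\<bar>h x\<bar> \<le> c * x\<^sup>2" "\<bar>k x\<bar> \<le> c * x\<^sup>2" using hk(1,2)[of x] e(2)[of x] x bdY by auto
        hence "y \<in> Y x" using x by (simp add: Y_def abs_le_iff)
        thus False using hk(4)[of x y] e(2)[of x] x by blast
      qed (auto simp: R_def)
      define D where "D = {0<..<e} \<times> (UNIV :: real set)"
      have D: "open D" by (auto simp: D_def intro: open_Times)
      have "continuous_on {0<..<e} h" "continuous_on {0<..<e} k"
        by (intro continuous_at_imp_continuous_on ballI; use e(2) in simp)+
      hence cont: "continuous_on D (\<lambda>p. h (fst p))" "continuous_on D (\<lambda>p. k (fst p))"
        by (auto intro!: continuous_on_compose2[where f = fst] continuous_intros simp: D_def)
      have "open (D \<inter> (\<lambda>p. snd p - k (fst p)) -` {0<..})" "open (D \<inter> (\<lambda>p. h (fst p) - snd p) -` {0<..})"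
        by (intro continuous_open_preimage continuous_intros cont D open_greaterThan)+
      hence "open (D \<inter> (\<lambda>p. snd p - k (fst p)) -` {0<..} \<inter> (D \<inter> (\<lambda>p. h (fst p) - snd p) -` {0<..}) \<inter> ball 0 (2 * r))"
        by (rule open_Int[OF open_Int open_ball])
      also have "D \<inter> (\<lambda>p. snd p - k (fst p)) -` {0<..} \<inter> (D \<inter> (\<lambda>p. h (fst p) - snd p) -` {0<..}) \<inter> ball 0 (2 * r) = R"
        by (auto simp: R_def D_def)
      finally show "open R" .
      \<comment> \<open>A limit over \<open>x = 0\<close> is squeezed to the origin by
        \<open>c * x\<^sup>2\<close>, hence lies in \<open>X\<close>; over \<open>x > 0\<close> a
        limit outside the open strip lies on one of the two graphs, which are contained in
        \<open>X\<close>.\<close>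
      have "(ball 0 (2 * r) - X) \<inter> closure R \<subseteq> R"
      proof safe
        fix x y assume xy: "(x, y) \<in> ball 0 (2 * r)" "(x, y) \<notin> X" "(x, y) \<in> closure R"
        then obtain p where p: "\<And>n. p n \<in> R" "p \<longlonglongrightarrow> (x, y)" unfolding closure_sequential by blast
        define a where "a n = fst (p n)" for n
        define b where "b n = snd (p n)" for n
        have lim: "a \<longlonglongrightarrow> x" "b \<longlonglongrightarrow> y"
          using tendsto_fst[OF p(2)] tendsto_snd[OF p(2)] by (simp_all add: a_def[abs_def] b_def[abs_def])
        have ab: "0 < a n" "a n < e" "k (a n) < b n" "b n < h (a n)" for n
          using p(1)[of n] by (auto simp: R_def a_def b_def split_beta)
        have "\<bar>b n\<bar> \<le> c * (a n)\<^sup>2" for n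
        proof -
          have "\<bar>h (a n)\<bar> \<le> c * (a n)\<^sup>2" "\<bar>k (a n)\<bar> \<le> c * (a n)\<^sup>2"
            using hk(1,2)[of "a n"] e(2)[of "a n"] ab[of n] bdY by auto
          thus ?thesis using ab(3,4)[of n] by (simp add: abs_le_iff)
        qed
        hence yx: "\<bar>y\<bar> \<le> c * x\<^sup>2"
          by (intro LIMSEQ_le[OF tendsto_rabs[OF lim(2)] tendsto_mult[OF tendsto_const tendsto_power[OF lim(1)]]]) auto
        have "x \<ge> 0" by (rule LIMSEQ_le_const[OF lim(1)]) (use ab(1) in \<open>auto intro: less_imp_le\<close>)
        moreover have "x \<noteq> 0" using yx xy(2) X(3) by auto
        ultimately have x: "0 < x" "x < e" using fst_less[OF xy(1)] by auto
        have "k x \<le> y"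
          by (rule LIMSEQ_le[OF isCont_tendsto_compose[OF _ lim(1)] lim(2)])
             (use e(2)[OF x] ab(3) in \<open>auto intro: less_imp_le\<close>)
        moreover have "y \<le> h x"
          by (rule LIMSEQ_le[OF lim(2) isCont_tendsto_compose[OF _ lim(1)]])
             (use e(2)[OF x] ab(4) in \<open>auto intro: less_imp_le\<close>)
        moreover have "(x, k x) \<in> X" "(x, h x) \<in> X" using hk(1,2)[of x] e(2)[OF x] by (auto simp: Y_def)
        hence "y \<noteq> k x" "y \<noteq> h x" using xy(2) by auto
        ultimately show "(x, y) \<in> R" using x xy(1) by (simp add: R_def)
      qed
      moreover have "R \<subseteq> (ball 0 (2 * r) - X) \<inter> closure R"
        using \<open>R \<subseteq> ball 0 (2 * r) - X\<close> closure_subset by blast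
      ultimately have "R = (ball 0 (2 * r) - X) \<inter> closure R" by (rule antisym[rotated])
      thus "closedin (top_of_set (ball 0 (2 * r) - X)) R" by (metis closedin_closed closed_closure)
    qed
    thus False by (auto simp: R_def)
  qed
  show ?thesis
  proof (cases "\<forall>\<^sub>F x in at_right 0. Y x \<noteq> {}")
    case False
    hence "\<forall>\<^sub>F x in at_right 0. Y x = {}" using dich1 by blast
    \<comment> \<open>Empty fibres are recorded by \<open>False\<close>, with 0 as default for both
      edges.\<close>
    hence "\<forall>\<^sub>F x in at_right 0. tame c (\<lambda>_. 0) x \<and> tame c (\<lambda>_. 0) x \<and> - (\<lambda>_. 0) x \<le> (\<lambda>_. 0::real) x \<and>
      (\<forall>y. (x, y) \<in> X \<and> \<bar>y\<bar> \<le> c * x\<^sup>2 \<longleftrightarrow> False \<and> - (\<lambda>_. 0) x \<le> y \<and> y \<le> (\<lambda>_. 0) x)"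
      by eventually_elim (use c in \<open>auto simp: tame_zero Y_def\<close>)
    thus ?thesis by blast
  next
    case True
    define u where "u x = total_Sup {y. y \<in> Y x}" for x
    define l where "l x = total_Sup {y. - y \<in> Y x}" for x
    have defu: "definable_function S u" unfolding u_def
      by (intro definable_function_Sup Y; simp add: dterm_nth)
    have defl: "definable_function S l" unfolding l_def
      by (intro definable_function_Sup Y definable_intros; simp add: dterm_nth)
    have u: "u x \<in> Y x" "y \<in> Y x \<Longrightarrow> y \<le> u x" if "Y x \<noteq> {}" for x y
      using total_Sup_closed[OF clY that bddY] by (auto simp: u_def)
    have l: "- l x \<in> Y x" "y \<in> Y x \<Longrightarrow> - l x \<le> y" if "Y x \<noteq> {}" for x y
    proof -
      have "closed ((\<lambda>y. - y) -` Y x)" by (intro closed_vimage clY continuous_intros)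
      hence "closed {y. - y \<in> Y x}" by (simp add: vimage_def)
      moreover have "{y. - y \<in> Y x} \<noteq> {}" using that by (metis (mono_tags, lifting) Collect_empty_eq ex_in_conv minus_minus)
      moreover have "bdd_above {y. - y \<in> Y x}" unfolding bdd_above_def using bdY[of "- _" x] by (force simp: abs_le_iff)
      ultimately have "l x \<in> {y. - y \<in> Y x}" "\<And>y. y \<in> {y. - y \<in> Y x} \<Longrightarrow> y \<le> l x"
        unfolding l_def by (rule total_Sup_closed)+
      from this(1) this(2)[of "- y"] show "- l x \<in> Y x" "y \<in> Y x \<Longrightarrow> - l x \<le> y" by auto
    qed
    have "\<forall>\<^sub>F x in at_right 0. \<bar>u x\<bar> \<le> c * x\<^sup>2" "\<forall>\<^sub>F x in at_right 0. \<bar>l x\<bar> \<le> c * x\<^sup>2"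
      using True by (eventually_elim; use u(1) l(1) bdY in fastforce)+
    from definable_tame[OF defu this(1)] definable_tame[OF defl this(2)] True
    have "\<forall>\<^sub>F x in at_right 0. tame c l x \<and> tame c u x \<and> Y x \<noteq> {}" by eventually_elim simp
    moreover have "\<forall>\<^sub>F x in at_right 0. G x = {}" using dich2 nogap by blast
    ultimately have "\<forall>\<^sub>F x in at_right 0. tame c l x \<and> tame c u x \<and> - l x \<le> u x \<and>
      (\<forall>y. (x, y) \<in> X \<and> \<bar>y\<bar> \<le> c * x\<^sup>2 \<longleftrightarrow> True \<and> - l x \<le> y \<and> y \<le> u x)"
    proof eventually_elim
      case (elim x)
      hence ne: "Y x \<noteq> {}" by blast
      have "y \<in> Y x \<longleftrightarrow> - l x \<le> y \<and> y \<le> u x" for y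
      proof
        assume y: "- l x \<le> y \<and> y \<le> u x"
        show "y \<in> Y x"
        proof (rule ccontr)
          assume "y \<notin> Y x"
          hence "- l x < y" "y < u x" using y l(1)[OF ne] u(1)[OF ne] by (auto simp: less_le)
          hence "y \<in> G x" using \<open>y \<notin> Y x\<close> l(1)[OF ne] u(1)[OF ne] by (auto simp: G_def)
          thus False using elim by blast
        qed
      qed (use l(2)[OF ne] u(2)[OF ne] in blast)
      moreover have "- l x \<le> u x" using u(2)[OF ne l(1)[OF ne]] .
      ultimately show ?case using elim by (simp add: Y_def)
    qed
    thus ?thesis by blast
  qed
qed

end

section \<open>Exponents below 2 and polynomial boundedness\<close>

context polynomially_bounded_o_minimal_structure
begin

text \<open>The supremum need not be attained, so only exponents below 2 are available; an
  admissible \<open>\<theta>' > \<theta>\<close> may be lowered to \<open>\<theta>\<close> because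
  \<bar>x\<bar> < 1.\<close>

lemma curvature_bound:
  assumes "general_curvature X \<ge> 2" "\<theta> < 2"
  shows "\<exists>c>0. \<exists>\<rho>>0. \<forall>x y. (x, y) \<in> X \<longrightarrow> \<bar>x\<bar> < \<rho> \<longrightarrow> \<bar>y\<bar> < \<rho> \<longrightarrow> \<bar>y\<bar> \<le> c * \<bar>x\<bar> powr \<theta>"
proof -
  have "ereal \<theta> < 2" using assms(2) by simp
  hence "ereal \<theta> < general_curvature X" using assms(1) by (rule less_le_trans)
  then obtain \<theta>' c where \<theta>': "\<theta> < \<theta>'" "c > 0" "germ_subset X {(x, y). \<bar>y\<bar> \<le> c * \<bar>x\<bar> powr \<theta>'}"
    unfolding general_curvature_def less_Sup_iff by auto
  then obtain U where U: "open U" "0 \<in> U" "X \<inter> U \<subseteq> {(x, y). \<bar>y\<bar> \<le> c * \<bar>x\<bar> powr \<theta>'}"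
    by (auto simp: germ_subset_def)
  then obtain e where e: "e > 0" "ball 0 e \<subseteq> U" using open_contains_ball by metis
  have "\<bar>y\<bar> \<le> c * \<bar>x\<bar> powr \<theta>" if "(x, y) \<in> X" "\<bar>x\<bar> < min (e / 2) 1" "\<bar>y\<bar> < min (e / 2) 1" for x y
  proof -
    have "norm (x, y) < e" using norm_Pair_le[of x y] that by simp
    hence "(x, y) \<in> X \<inter> U" using that e by auto
    hence "\<bar>y\<bar> \<le> c * \<bar>x\<bar> powr \<theta>'" using U(3) by blast
    also have "\<dots> \<le> c * \<bar>x\<bar> powr \<theta>" using \<theta>' that by (intro mult_left_mono powr_mono') auto
    finally show ?thesis .
  qed
  thus ?thesis using \<theta>'(2) e(1) by (intro exI[of _ c] conjI exI[of _ "min (e / 2) 1"]) auto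
qed

text \<open>If no such \<open>c\<close> existed, the largest \<open>\<bar>x\<bar>\<close> for which \<open>\<bar>y\<bar> > t x\<^sup>2\<close> occurs on \<open>X\<close> would tend
  to \<open>0\<close> faster than any negative power of \<open>t\<close>; its inverse is definable, contradicting polynomial
  boundedness.\<close>
lemma quadratic_bound:
  assumes X: "definable_planar S X" and curv: "general_curvature X \<ge> 2"
  shows "\<exists>c>0. \<exists>\<rho>>0. \<forall>x y. (x, y) \<in> X \<longrightarrow> \<bar>x\<bar> < \<rho> \<longrightarrow> \<bar>y\<bar> < \<rho> \<longrightarrow> \<bar>y\<bar> \<le> c * x\<^sup>2"
proof (rule ccontr)
  assume neg: "\<not> ?thesis"
  obtain c1 \<rho>1 where c1: "c1 > 0" "\<rho>1 > 0"
    "\<And>x y. (x, y) \<in> X \<Longrightarrow> \<bar>x\<bar> < \<rho>1 \<Longrightarrow> \<bar>y\<bar> < \<rho>1 \<Longrightarrow> \<bar>y\<bar> \<le> c1 * \<bar>x\<bar>"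
    using curvature_bound[OF curv, of 1] by auto
  define A where "A t z \<longleftrightarrow> 0 < z \<and> z < \<rho>1 \<and> (\<exists>y. \<bar>y\<bar> < \<rho>1 \<and> t * z\<^sup>2 < \<bar>y\<bar> \<and> ((z, y) \<in> X \<or> (- z, y) \<in> X))" for t z
  define F where "F t = inverse (total_Sup {z. A t z})" for t
  have "definable_function S (\<lambda>t. total_Sup {z. A t z})"
    unfolding A_def by (intro definable_function_Sup definable_intros dpred_planar[OF X]; simp add: dterm_nth)
  from dterm_inverse[OF dterm_fun[OF this]] have "dterm 2 (\<lambda>xs. F (xs ! 0))"
    unfolding F_def by (simp add: dterm_nth)
  hence "definable_function S F"
    unfolding definable_function_iff by (intro dpred_eq dterm_nth; simp)
  then obtain N where N: "\<forall>\<^sub>F t in at_top. \<bar>F t\<bar> \<le> t ^ N" using polynomially_bounded by blast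
  \<comment> \<open>With exponent \<open>2 - 1 / M\<close>, the condition
    \<open>t * z\<^sup>2 < c2 * z powr (2 - 1 / M)\<close> yields
    \<open>z \<le> (c2 / t) ^ M\<close>; as \<open>M\<close> exceeds \<open>N\<close> by one,
    \<open>F\<close> outgrows \<open>t ^ N\<close>.\<close>
  define M where "M = Suc N"
  have M: "M > 0" by (simp add: M_def)
  obtain c2 \<rho>2 where c2: "c2 > 0" "\<rho>2 > 0"
    "\<And>x y. (x, y) \<in> X \<Longrightarrow> \<bar>x\<bar> < \<rho>2 \<Longrightarrow> \<bar>y\<bar> < \<rho>2 \<Longrightarrow> \<bar>y\<bar> \<le> c2 * \<bar>x\<bar> powr (2 - 1 / M)"
    using curvature_bound[OF curv, of "2 - 1 / M"] by (auto simp: M_def)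
  \<comment> \<open>Chosen so that \<open>z < \<eta>\<close> puts both coordinates below
    \<open>\<rho>2\<close>, the second through the linear bound with \<open>c1\<close>.\<close>
  define \<eta> where "\<eta> = min \<rho>2 (\<rho>2 / c1)"
  have \<eta>: "\<eta> > 0" using c1 c2 by (simp add: \<eta>_def)
  \<comment> \<open>Since \<open>t * z\<^sup>2 < \<rho>1\<close> on \<open>A t\<close>, the bound
    \<open>t \<ge> \<rho>1 / \<eta>\<^sup>2\<close> forces \<open>z < \<eta>\<close>;
    \<open>t > c2 ^ M\<close> gives the final contradiction.\<close>
  have "\<forall>\<^sub>F t in at_top. \<bar>F t\<bar> \<le> t ^ N \<and> t > 0 \<and> t \<ge> \<rho>1 / \<eta>\<^sup>2 \<and> t > c2 ^ M"
    using N by (intro eventually_conj eventually_gt_at_top eventually_ge_at_top)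
  then obtain t where t: "\<bar>F t\<bar> \<le> t ^ N" "t > 0" "t \<ge> \<rho>1 / \<eta>\<^sup>2" "t > c2 ^ M"
    using eventually_happens'[of "at_top :: real filter"] by (auto simp del: abs_le_iff)
  have bound: "z \<le> (c2 / t) ^ M" if A: "A t z" for z
  proof -
    obtain y where y: "0 < z" "z < \<rho>1" "\<bar>y\<bar> < \<rho>1" "t * z\<^sup>2 < \<bar>y\<bar>" "(z, y) \<in> X \<or> (- z, y) \<in> X"
      using A by (auto simp: A_def)
    obtain x where x: "(x, y) \<in> X" "\<bar>x\<bar> = z" using y(1,5) by force
    have "\<rho>1 \<le> t * \<eta>\<^sup>2" using t(3) \<eta> by (simp add: field_simps)
    hence "t * z\<^sup>2 < t * \<eta>\<^sup>2" using y by linarith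
    hence "z\<^sup>2 < \<eta>\<^sup>2" using t(2) by simp
    hence "z < \<eta>" using \<eta> power2_less_imp_less[of z \<eta>] by simp
    hence z: "z < \<rho>2" "c1 * z < \<rho>2" using c1(1) by (auto simp: \<eta>_def field_simps)
    have "\<bar>y\<bar> < \<rho>2" using c1(3)[OF x(1)] x(2) y z by simp
    hence "t * z\<^sup>2 < c2 * z powr (2 - 1 / M)" using c2(3)[OF x(1)] x(2) y z by simp
    also have "z powr (2 - 1 / M) = z\<^sup>2 / z powr (1 / M)" using y(1) by (simp add: powr_diff)
    finally have "z powr (1 / M) < c2 / t" using y(1) t(2) by (simp add: field_simps)
    hence "(z powr (1 / M)) ^ M \<le> (c2 / t) ^ M" by (intro power_mono) auto
    also have "(z powr (1 / M)) ^ M = z" using y(1) M by (simp add: powr_power)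
    finally show ?thesis .
  qed
  have "\<exists>x y. (x, y) \<in> X \<and> \<bar>x\<bar> < \<rho>1 \<and> \<bar>y\<bar> < \<rho>1 \<and> t * x\<^sup>2 < \<bar>y\<bar>"
    using neg t(2) c1(2) by (force simp: not_le)
  then obtain x y where xy: "(x, y) \<in> X" "\<bar>x\<bar> < \<rho>1" "\<bar>y\<bar> < \<rho>1" "t * x\<^sup>2 < \<bar>y\<bar>" by blast
  \<comment> \<open>Over \<open>x = 0\<close> the linear bound leaves only \<open>y = 0\<close>,
    which violates the strict inequality.\<close>
  have "x \<noteq> 0" using c1(3)[OF xy(1-3)] xy(4) by auto
  hence A: "A t \<bar>x\<bar>" using xy by (auto simp: A_def abs_if intro!: exI[of _ y])
  have bdd: "bdd_above {z. A t z}" using bound by (auto simp: bdd_above_def)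
  have "total_Sup {z. A t z} = Sup {z. A t z}" using A bdd by (auto simp: total_Sup_def)
  moreover have "\<bar>x\<bar> \<le> Sup {z. A t z}" using A bdd by (intro cSup_upper) auto
  moreover have "Sup {z. A t z} \<le> (c2 / t) ^ M" using A bound by (intro cSup_least) auto
  ultimately have "inverse ((c2 / t) ^ M) \<le> F t"
    unfolding F_def using \<open>x \<noteq> 0\<close> by (intro le_imp_inverse_le) auto
  also have "inverse ((c2 / t) ^ M) = t ^ N * (t / c2 ^ M)" by (simp add: M_def field_simps)
  finally have "t ^ N * (t / c2 ^ M) \<le> t ^ N * 1" using t(1) by linarith
  hence "t / c2 ^ M \<le> 1" using t(2) by (simp only: mult_le_cancel_left zero_less_power) 
  thus False using t(4) c2(1) by (simp add: field_simps)
qed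

end

subsection \<open>The medial axis\<close>

lemma medial_axis_two_points:
  assumes "p \<in> medial_axis X"
  obtains a b where "a \<noteq> b" "a \<in> X" "b \<in> X" "dist p a = infdist p X" "dist p b = infdist p X"
proof -
  have "\<exists>a\<in>nearest_points X p. \<exists>b\<in>nearest_points X p. a \<noteq> b"
  proof (rule ccontr)
    assume neg: "\<not> ?thesis"
    then obtain a where a: "nearest_points X p \<subseteq> {a}" by blast
    have "finite (nearest_points X p)" "card (nearest_points X p) \<le> card {a}"
      using finite_subset[OF a] card_mono[OF _ a] by simp_all
    thus False using assms by (auto simp: medial_axis_def)
  qed
  thus ?thesis using that by (auto simp: nearest_points_def)
qed

text \<open>The reflection is a norm-preserving continuous involution that fixes the vertical axis
  pointwise, so clopen sets pull back and the marked points are kept.\<close>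

lemma clopen_filled_reflect:
  fixes X :: "(real \<times> real) set"
  defines "\<phi> \<equiv> \<lambda>(x, y). (- x, y)"
  assumes filled: "clopen_filled X"
  shows "clopen_filled (\<phi> -` X)"
proof -
  have invol: "\<phi> (\<phi> p) = p" for p by (simp add: \<phi>_def split_beta)
  have cont: "continuous_on A \<phi>" for A by (auto simp: \<phi>_def split_beta intro!: continuous_intros)
  have norm: "norm (\<phi> p) = norm p" for p by (cases p) (simp add: \<phi>_def norm_Pair)
  have ball: "\<phi> -` (ball 0 s - \<phi> -` X) = ball 0 s - X" for s
    by (rule set_eqI) (simp only: vimage_eq Diff_iff mem_ball_0 invol norm)
  obtain r0 where r0: "r0 > 0" "\<And>r R. 0 < r \<Longrightarrow> r < r0 \<Longrightarrow> R \<noteq> {} \<Longrightarrow> R \<subseteq> ball 0 (2 * r) - X \<Longrightarrow>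
      open R \<Longrightarrow> closedin (top_of_set (ball 0 (2 * r) - X)) R \<Longrightarrow> (0, r) \<in> R \<or> (0, - r) \<in> R"
    using filled unfolding clopen_filled_def by blast
  have "(0, r) \<in> R \<or> (0, - r) \<in> R"
    if r: "0 < r" "r < r0" and R: "R \<noteq> {}" "R \<subseteq> ball 0 (2 * r) - \<phi> -` X" "open R"
      "closedin (top_of_set (ball 0 (2 * r) - \<phi> -` X)) R" for r R
  proof -
    obtain T where T: "closed T" "R = (ball 0 (2 * r) - \<phi> -` X) \<inter> T" using R(4) by (auto simp: closedin_closed)
    have "\<phi> -` R = (ball 0 (2 * r) - X) \<inter> \<phi> -` T" unfolding T(2) vimage_Int ball ..
    moreover have "closed (\<phi> -` T)" using T(1) cont by (simp add: closed_vimage)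
    ultimately have "closedin (top_of_set (ball 0 (2 * r) - X)) (\<phi> -` R)" by (auto simp: closedin_closed)
    moreover have "open (\<phi> -` R)" using R(3) cont by (simp add: open_vimage)
    moreover have "\<phi> -` R \<subseteq> ball 0 (2 * r) - X" using vimage_mono[OF R(2), of \<phi>] unfolding ball .
    moreover have "\<phi> -` R \<noteq> {}"
    proof -
      obtain p where "p \<in> R" using R(1) by blast
      hence "\<phi> p \<in> \<phi> -` R" by (simp add: invol)
      thus ?thesis by blast
    qed
    ultimately have "(0, r) \<in> \<phi> -` R \<or> (0, - r) \<in> \<phi> -` R" by (intro r0(2)[OF r])
    thus ?thesis by (simp add: \<phi>_def)
  qed
  thus ?thesis unfolding clopen_filled_def using r0(1) by blast
qed

theorem theorem3p5:
  fixes S :: "nat \<Rightarrow> real list set set" and X :: "(real \<times> real) set"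
  assumes "polynomially_bounded_o_minimal_structure S"
    and "definable_planar S X"
    and "closed X"
    and "0 \<in> X"
    and "\<not> germ_subset UNIV X"
    and "affine hull (tangent_cone X) = UNIV \<times> {0}"
    and "filled_horizontally X"
    and "general_curvature X \<ge> 2"
  shows "0 \<notin> closure (medial_axis X)"
proof
  assume cl: "0 \<in> closure (medial_axis X)"
  interpret polynomially_bounded_o_minimal_structure S by fact
  obtain c \<rho> where c: "c > 0" and \<rho>: "\<rho> > 0"
    "\<And>x y. (x, y) \<in> X \<Longrightarrow> \<bar>x\<bar> < \<rho> \<Longrightarrow> \<bar>y\<bar> < \<rho> \<Longrightarrow> \<bar>y\<bar> \<le> c * x\<^sup>2"
    using quadratic_bound[OF assms(2,8)] by blast
  have X0: "(0, 0) \<in> X" using assms(4) by (simp add: zero_prod_def)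
  note filled = filled_horizontally_imp_clopen_filled[OF assms(7)]
  obtain l1 u1 P1 where right: "\<forall>\<^sub>F x in at_right 0. tame c l1 x \<and> tame c u1 x \<and> - l1 x \<le> u1 x \<and>
    (\<forall>y. (x, y) \<in> X \<and> \<bar>y\<bar> \<le> c * x\<^sup>2 \<longleftrightarrow> P1 \<and> - l1 x \<le> y \<and> y \<le> u1 x)"
    using right_branch[OF assms(2,3) X0 c filled] by blast
  \<comment> \<open>Reflection turns the branch over \<open>x < 0\<close> into one over
    \<open>x > 0\<close>.\<close>
  define X' where "X' = (\<lambda>(x, y). (- x, y)) -` X"
  have "definable_planar S X'"
    unfolding definable_planar_iff X'_def vimage_eq case_prod_conv
    by (intro dpred_planar[OF assms(2)] definable_intros; simp)
  moreover have "closed X'" unfolding X'_def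
    by (intro closed_vimage assms(3)) (auto simp: split_beta intro!: continuous_intros)
  moreover have "(0, 0) \<in> X'" using X0 by (simp add: X'_def)
  ultimately obtain l2 u2 P2 where left: "\<forall>\<^sub>F x in at_right 0. tame c l2 x \<and> tame c u2 x \<and> - l2 x \<le> u2 x \<and>
    (\<forall>y. (x, y) \<in> X' \<and> \<bar>y\<bar> \<le> c * x\<^sup>2 \<longleftrightarrow> P2 \<and> - l2 x \<le> y \<and> y \<le> u2 x)"
    using right_branch[OF _ _ _ c clopen_filled_reflect[OF filled, folded X'_def]] by blast
  obtain e where e: "e > 0"
    "\<And>x. 0 < x \<Longrightarrow> x < e \<Longrightarrow> tame c l1 x \<and> tame c u1 x \<and> - l1 x \<le> u1 x \<and>
       (\<forall>y. (x, y) \<in> X \<and> \<bar>y\<bar> \<le> c * x\<^sup>2 \<longleftrightarrow> P1 \<and> - l1 x \<le> y \<and> y \<le> u1 x)"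
    "\<And>x. 0 < x \<Longrightarrow> x < e \<Longrightarrow> tame c l2 x \<and> tame c u2 x \<and> - l2 x \<le> u2 x \<and>
       (\<forall>y. (x, y) \<in> X' \<and> \<bar>y\<bar> \<le> c * x\<^sup>2 \<longleftrightarrow> P2 \<and> - l2 x \<le> y \<and> y \<le> u2 x)"
    using eventually_conj[OF right left] unfolding eventually_at_right_field by blast
  define l where "l = glue l2 0 l1"
  define u where "u = glue u2 0 u1"
  \<comment> \<open>The value at 0 is \<open>True\<close> because the origin lies in
    \<open>X\<close>.\<close>
  define P where "P = glue (\<lambda>_. P2) True (\<lambda>_. P1)"
  have tame: "tame c l x" "tame c u x" if "\<bar>x\<bar> < e" for x
    unfolding l_def u_def by (rule tame_glue[OF _ _ _ that]; use c e in simp)+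
  have lu: "- l x \<le> u x" if "\<bar>x\<bar> < e" for x
    using that e(2)[of x] e(3)[of "- x"] by (auto simp: l_def u_def glue_def)
  have X_iff: "(x, y) \<in> X \<and> \<bar>y\<bar> \<le> c * x\<^sup>2 \<longleftrightarrow> P x \<and> - l x \<le> y \<and> y \<le> u x" if "\<bar>x\<bar> < e" for x y
  proof -
    consider "x > 0" | "x < 0" | "x = 0" by linarith
    thus ?thesis
    proof cases
      case 1
      thus ?thesis using that e(2)[of x] by (simp add: l_def u_def P_def glue_def)
    next
      case 2
      thus ?thesis using that e(3)[of "- x"] by (simp add: l_def u_def P_def glue_def X'_def)
    qed (use X0 in \<open>auto simp: l_def u_def P_def glue_def\<close>)
  qed
  define K where "K = 18 * c + 1"
  have K: "K > 0" using c by (simp add: K_def)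
  have midpoint: "\<exists>q\<in>X. dist q ((1/2) *\<^sub>R (a + b)) \<le> K / 8 * (dist a b)\<^sup>2"
    if ab: "a \<in> X" "b \<in> X" "norm a < min e \<rho>" "norm b < min e \<rho>" for a b
  proof -
    obtain a1 a2 b1 b2 where eq: "a = (a1, a2)" "b = (b1, b2)" by fastforce
    have small: "\<bar>a1\<bar> < e" "\<bar>b1\<bar> < e" "\<bar>a1\<bar> < \<rho>" "\<bar>b1\<bar> < \<rho>" "\<bar>a2\<bar> < \<rho>" "\<bar>b2\<bar> < \<rho>"
      using ab(3,4) norm_fst_le[of a1 a2] norm_snd_le[of a2 a1] norm_fst_le[of b1 b2] norm_snd_le[of b2 b1]
      by (auto simp: eq)
    have a: "P a1" "- l a1 \<le> a2" "a2 \<le> u a1" using X_iff[OF small(1)] \<rho>(2)[of a1 a2] ab small by (auto simp: eq)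
    have b: "P b1" "- l b1 \<le> b2" "b2 \<le> u b1" using X_iff[OF small(2)] \<rho>(2)[of b1 b2] ab small by (auto simp: eq)
    define m where "m = (a1 + b1) / 2"
    define z where "z = (a2 + b2) / 2"
    \<comment> \<open>Projection of the height \<open>z\<close> of the midpoint onto the fibre over
      \<open>m\<close>.\<close>
    define y where "y = max (- l m) (min (u m) z)"
    have m: "\<bar>m\<bar> < e" using small by (auto simp: m_def abs_less_iff)
    \<comment> \<open>If \<open>m\<close> is nonzero, one of \<open>a1\<close> and \<open>b1\<close>
      has its sign, and \<open>P\<close> is constant on each side of 0.\<close>
    have "P m"
      using a(1) b(1) by (auto simp: P_def glue_def m_def split: if_splits)
    hence "(m, y) \<in> X" using X_iff[OF m, of y] lu[OF m] by (auto simp: y_def)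
    moreover have "dist (m, y) ((1/2) *\<^sub>R (a + b)) \<le> K / 8 * (dist a b)\<^sup>2"
    proof -
      define \<kappa> where "\<kappa> = K / 8 * (b1 - a1)\<^sup>2"
      have "\<kappa> \<ge> 0" using K by (simp add: \<kappa>_def)
      moreover have "(l a1 + l b1) / 2 - \<kappa> \<le> l m" "(u a1 + u b1) / 2 - \<kappa> \<le> u m"
        unfolding \<kappa>_def K_def m_def using tame small by (intro tame_midpoint; simp)+
      hence "l a1 + l b1 \<le> 2 * l m + 2 * \<kappa>" "u a1 + u b1 \<le> 2 * u m + 2 * \<kappa>" by (simp_all add: field_simps)
      moreover have "2 * z = a2 + b2" by (simp add: z_def)
      \<comment> \<open>Averaging the edge bounds at \<open>a1\<close> and \<open>b1\<close> shows
        that \<open>z\<close> leaves the fibre over \<open>m\<close> by at most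
        \<open>\<kappa>\<close>.\<close>
      ultimately have "\<bar>y - z\<bar> \<le> \<kappa>" using a(2,3) b(2,3) lu[OF m] unfolding y_def by linarith
      moreover have "\<bar>b1 - a1\<bar> \<le> \<bar>dist a b\<bar>"
        using dist_fst_le[of a b] by (simp add: eq dist_real_def abs_minus_commute)
      hence "(b1 - a1)\<^sup>2 \<le> (dist a b)\<^sup>2" by (simp only: abs_le_square_iff)
      hence "\<kappa> \<le> K / 8 * (dist a b)\<^sup>2" unfolding \<kappa>_def using K by (intro mult_left_mono) auto
      moreover have "(1/2) *\<^sub>R (a + b) = (m, z)" by (simp add: eq m_def z_def)
      ultimately show ?thesis by (simp add: dist_Pair_Pair dist_real_def)
    qed
    ultimately show ?thesis by blast
  qed
  \<comment> \<open>Nearest points of \<open>p\<close> have norm at most \<open>2 * norm p\<close>,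
    as the origin belongs to \<open>X\<close>; hence the halving. The bound \<open>1 / K\<close>
    serves \<open>nearest_point_unique\<close>.\<close>
  define \<delta> where "\<delta> = min (min e \<rho> / 2) (1 / K)"
  have "\<delta> > 0" using e(1) \<rho>(1) K by (simp add: \<delta>_def)
  then obtain p where p: "p \<in> medial_axis X" "dist p 0 < \<delta>" using cl closure_approachable by blast
  obtain a b where ab: "a \<noteq> b" "a \<in> X" "b \<in> X" "dist p a = infdist p X" "dist p b = infdist p X"
    using medial_axis_two_points[OF p(1)] .
  have d: "infdist p X \<le> norm p" using infdist_le[OF assms(4), of p] by (simp add: dist_norm)
  have "norm x < min e \<rho>" if "dist p x = infdist p X" for x
    using norm_triangle_ineq4[of p "p - x"] d that p(2) by (simp add: dist_norm \<delta>_def)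
  then obtain q where q: "q \<in> X" "dist q ((1/2) *\<^sub>R (a + b)) \<le> K / 8 * (dist a b)\<^sup>2"
    using midpoint ab by blast
  have "K * infdist p X \<le> K * norm p" using d K by simp
  also have "\<dots> < K * (1 / K)" using p(2) K by (intro mult_strict_left_mono) (auto simp: \<delta>_def)
  finally have "K * infdist p X < 1" using K by simp
  hence "a = b"
    using nearest_point_unique[OF ab(4,5) infdist_le[OF q(1)] _ _ q(2)] K by simp
  thus False using ab(1) by simp
qed

end
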